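(* Let $s\in\mathbb{N}$, $s\ge2$, and let $f\in W^{s,1}(\mathbb{R})\cap C_b(\mathbb{R})$. Then for each $r\in\mathbb{N}$ and every $h>0$, with $\sigma=2\pi/h$, $$|R_\sigma(f)|\le h^s\,\frac{\zeta(s)}{\pi^s2^{r+s-1}}\,\omega_r\Big(f^{(s)};\frac h2;L^1(\mathbb{R})\Big).$$ Furthermore, for every $h>0$, with $\sigma=2\pi/h$, $$|R_\sigma(f)|\le h^s\,\frac{\zeta(s)}{\pi^s2^{s-1}}\,\big\|f^{(s)}\big\|_{L^1(\mathbb{R})}.$$
   Context: Fourier transform: $\widehat f(v)=\frac{1}{\sqrt{2\pi}}\int_{\mathbb{R}} f(u)e^{-iuv}\,du$ for $f\in L^1(\mathbb{R})$. $\zeta$ is the Riemann zeta function. $C_b(\mathbb{R})$ is the class of continuous bounded functions $f:\mathbb{R}\to\mathbb{C}$. For $s\in\mathbb{N}$, $W^{s,1}(\mathbb{R})$ is the set of $f\in L^1(\mathbb{R})$ such that $f=\phi$ a.e. for some $\phi$ which is $(s-1)$-times locally absolutely continuous (i.e. $\phi,\dots,\phi^{(s-1)}$ are locally absolutely continuous) with $\phi^{(k)}\in L^1(\mathbb{R})$ for $0\le k\le s$; one writes $f^{(k)}$ for $\phi^{(k)}$. Modulus of smoothness of order $r\in\mathbb{N}$: for $g\in L^1(\mathbb{R})$ and $\delta>0$, $\omega_r(g;\delta;L^1(\mathbb{R}))=\sup_{|u|\le\delta}\|\Delta_u^r g\|_{L^1(\mathbb{R})}$, where $(\Delta_u^r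 g)(x)=\sum_{j=0}^r(-1)^{r-j}\binom{r}{j}g(x+ju)$. Let $\mathcal{A}=\{f\in L^1(\mathbb{R})\cap C_b(\mathbb{R}) : f\in \mathrm{BV}(\mathbb{R})\text{ or }\widehat f\in \mathrm{BV}(\mathbb{R})\}$, where $\mathrm{BV}(\mathbb{R})$ is the set of functions of bounded variation over $\mathbb{R}$. One has $W^{1,1}(\mathbb{R})\cap C_b(\mathbb{R})\subset\mathcal{A}$. For $f\in\mathcal{A}$, $\sigma>0$ and $h=2\pi/\sigma$, $R_\sigma(f)$ denotes the remainder in the quadrature formula $\int_{-\infty}^\infty f(t)\,dt=h\sum_{k\in\mathbb{Z}}f(hk)+R_\sigma(f)$; by the Poisson summation formula, $R_\sigma(f)=-\sqrt{2\pi}\sum_{k\in\mathbb{Z}\setminus\{0\}}\widehat f(k\sigma)$. *)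

theory Defs
  imports "HOL-Analysis.Analysis"
begin

definition absolutely_continuous_fun_on :: "real \<Rightarrow> real \<Rightarrow> (real \<Rightarrow> complex) \<Rightarrow> bool" where
  "absolutely_continuous_fun_on a b F \<longleftrightarrow>
     (\<forall>\<epsilon>>0. \<exists>\<delta>>0. \<forall>(n::nat) (u::nat \<Rightarrow> real) (v::nat \<Rightarrow> real).
        (\<forall>i<n. a \<le> u i \<and> u i \<le> v i \<and> v i \<le> b) \<longrightarrow>
        disjoint_family_on (\<lambda>i. {u i<..<v i}) {..<n} \<longrightarrow>
        (\<Sum>i<n. v i - u i) < \<delta> \<longrightarrow>
        (\<Sum>i<n. norm (F (v i) - F (u i))) < \<epsilon>)"

definition locally_absolutely_continuous :: "(real \<Rightarrow> complex) \<Rightarrow> bool" where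
  "locally_absolutely_continuous F \<longleftrightarrow> (\<forall>a b. a < b \<longrightarrow> absolutely_continuous_fun_on a b F)"

definition real_deriv :: "nat \<Rightarrow> (real \<Rightarrow> complex) \<Rightarrow> real \<Rightarrow> complex" where
  "real_deriv k F = ((\<lambda>g x. vector_derivative g (at x)) ^^ k) F"

(* Since vector_derivative is total, the existence (almost everywhere) of the derivatives is
   spelled out. This does not restrict the class: a locally absolutely continuous function is
   differentiable almost everywhere. Lebesgue (not just Borel) measurability is what is wanted
   for L^1 throughout: real_deriv s phi takes an arbitrary value on the null set where the
   last derivative does not exist. *)
definition sobolev_representative :: "nat \<Rightarrow> (real \<Rightarrow> complex) \<Rightarrow> (real \<Rightarrow> complex) \<Rightarrow> bool" where
  "sobolev_representative s f \<phi> \<longleftrightarrow>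
     (AE x in lebesgue. f x = \<phi> x) \<and>
     (\<forall>k<s. locally_absolutely_continuous (real_deriv k \<phi>) \<and>
            (AE x in lebesgue. real_deriv k \<phi> differentiable (at x))) \<and>
     (\<forall>k\<le>s. integrable lebesgue (real_deriv k \<phi>))"

definition sobolev_W1 :: "nat \<Rightarrow> (real \<Rightarrow> complex) set" where
  "sobolev_W1 s = {f. integrable lebesgue f \<and> (\<exists>\<phi>. sobolev_representative s f \<phi>)}"

(* The choice of representative is harmless: for s > 0 it is unique, because two continuous
   functions that agree almost everywhere are equal. *)
definition sobolev_deriv :: "nat \<Rightarrow> nat \<Rightarrow> (real \<Rightarrow> complex) \<Rightarrow> real \<Rightarrow> complex" where
  "sobolev_deriv s k f = real_deriv k (SOME \<phi>. sobolev_representative s f \<phi>)"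

definition L1_norm :: "(real \<Rightarrow> complex) \<Rightarrow> real" where
  "L1_norm g = (LINT x|lebesgue. norm (g x))"

definition finite_difference :: "nat \<Rightarrow> real \<Rightarrow> (real \<Rightarrow> complex) \<Rightarrow> real \<Rightarrow> complex" where
  "finite_difference r u g x =
     (\<Sum>j\<le>r. (- 1) ^ (r - j) * of_nat (r choose j) * g (x + real j * u))"

(* For integrable g the supremum is over a set bounded by 2 ^ r * L1_norm g. *)
definition modulus_of_smoothness :: "nat \<Rightarrow> (real \<Rightarrow> complex) \<Rightarrow> real \<Rightarrow> real" where
  "modulus_of_smoothness r g \<delta> = (SUP u\<in>{-\<delta>..\<delta>}. L1_norm (finite_difference r u g))"

(* The bilateral series is taken as the limit of its symmetric partial sums, which gives the
   value of the series under every usual notion of its convergence. *)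
definition quadrature_remainder :: "real \<Rightarrow> (real \<Rightarrow> complex) \<Rightarrow> complex" where
  "quadrature_remainder \<sigma> f =
     (let h = 2 * pi / \<sigma>
      in (LINT t|lebesgue. f t) -
         complex_of_real h * lim (\<lambda>N::nat. \<Sum>k\<in>{- int N..int N}. f (h * real_of_int k)))"

(* The Riemann zeta function on the half-line s > 1, where it is given by its Dirichlet series. *)
definition riemann_zeta :: "real \<Rightarrow> real" where
  "riemann_zeta s = (\<Sum>n. 1 / real (Suc n) powr s)"

end

theory Submission
  imports Defs "HOL-Real_Asymp.Real_Asymp"
begin

text \<open>With \<open>B\<^sub>2(t) = t\<^sup>2 - t + 1/6\<close> and \<open>{y}\<close> the fractional part of \<open>y\<close>, the Euler-Maclaurin formula
  of order two expresses the remainder of the quadrature formula as \<open>\<integral> f'' (x) K(x) dx\<close>, where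
  \<open>K(x) = h\<^sup>2 B\<^sub>2({x/h}) / 2\<close>. Since \<open>s \<ge> 2\<close>, the Fourier series \<open>K(x) = \<Sum>\<^sub>k 2 cos (w\<^sub>k x) / w\<^sub>k\<^sup>2\<close>,
  \<open>w\<^sub>k = 2 \<pi> k / h\<close>, converges absolutely and may be integrated term by term; this takes the place
  of the Poisson summation formula. Integrating by parts \<open>s - 2\<close> more times turns the \<open>k\<close>-th term
  into Fourier integrals of \<open>f\<^sup>(\<^sup>s\<^sup>)\<close> at \<open>\<plusminus> w\<^sub>k\<close> divided by \<open>w\<^sub>k\<^sup>s\<close>. Translating by \<open>\<pi> / w\<^sub>k \<le> h / 2\<close>
  changes the sign of such an integral, so that it equals \<open>(-2)\<close> to the power \<open>-r\<close> times the
  Fourier integral of the \<open>r\<close>-th difference, and summing over \<open>k\<close> produces \<open>\<zeta>(s)\<close>.\<close>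

section \<open>Absolutely continuous functions\<close>

lemma absolutely_continuous_fun_onE:
  assumes "absolutely_continuous_fun_on a b F" "\<epsilon> > 0"
  obtains \<delta> where "\<delta> > 0"
    "\<And>(n::nat) u v. \<lbrakk>\<And>i. i < n \<Longrightarrow> a \<le> u i \<and> u i \<le> v i \<and> v i \<le> b;
       disjoint_family_on (\<lambda>i. {u i<..<v i}) {..<n}; (\<Sum>i<n. v i - u i) < \<delta>\<rbrakk>
       \<Longrightarrow> (\<Sum>i<n. norm (F (v i) - F (u i))) < \<epsilon>"
  using assms unfolding absolutely_continuous_fun_on_def by blast

lemma absolutely_continuous_imp_continuous_on:
  assumes "absolutely_continuous_fun_on a b F"
  shows "continuous_on {a..b} F"
  unfolding continuous_on_iff
proof (intro ballI allI impI)
  fix x and e :: real assume x: "x \<in> {a..b}" and "e > 0"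
  obtain \<delta> where "\<delta> > 0" and
    \<delta>: "\<And>(n::nat) u v. \<lbrakk>\<And>i. i < n \<Longrightarrow> a \<le> u i \<and> u i \<le> v i \<and> v i \<le> b;
       disjoint_family_on (\<lambda>i. {u i<..<v i}) {..<n}; (\<Sum>i<n. v i - u i) < \<delta>\<rbrakk>
       \<Longrightarrow> (\<Sum>i<n. norm (F (v i) - F (u i))) < e"
    by (rule absolutely_continuous_fun_onE[OF assms \<open>e > 0\<close>]) blast
  show "\<exists>d>0. \<forall>x'\<in>{a..b}. dist x' x < d \<longrightarrow> dist (F x') (F x) < e"
  proof (intro exI[of _ \<delta>] conjI ballI impI \<open>\<delta> > 0\<close>)
    fix y assume "y \<in> {a..b}" "dist y x < \<delta>"
    then show "dist (F y) (F x) < e"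
      using \<delta>[of 1 "\<lambda>_. x" "\<lambda>_. y"] \<delta>[of 1 "\<lambda>_. y" "\<lambda>_. x"] x
      by (cases "x \<le> y") (auto simp: dist_norm disjoint_family_on_def norm_minus_commute)
  qed
qed

lemma absolutely_continuous_fun_on_add:
  assumes F: "absolutely_continuous_fun_on a b F" and G: "absolutely_continuous_fun_on a b G"
  shows "absolutely_continuous_fun_on a b (\<lambda>x. F x + G x)"
  unfolding absolutely_continuous_fun_on_def
proof (intro allI impI)
  fix e :: real assume "e > 0"
  then have e2: "e / 2 > 0" by simp
  obtain d1 where d1: "d1 > 0"
    "\<And>(n::nat) u v. \<lbrakk>\<And>i. i < n \<Longrightarrow> a \<le> u i \<and> u i \<le> v i \<and> v i \<le> b;
       disjoint_family_on (\<lambda>i. {u i<..<v i}) {..<n}; (\<Sum>i<n. v i - u i) < d1\<rbrakk>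
       \<Longrightarrow> (\<Sum>i<n. norm (F (v i) - F (u i))) < e / 2"
    by (rule absolutely_continuous_fun_onE[OF F e2]) blast
  obtain d2 where d2: "d2 > 0"
    "\<And>(n::nat) u v. \<lbrakk>\<And>i. i < n \<Longrightarrow> a \<le> u i \<and> u i \<le> v i \<and> v i \<le> b;
       disjoint_family_on (\<lambda>i. {u i<..<v i}) {..<n}; (\<Sum>i<n. v i - u i) < d2\<rbrakk>
       \<Longrightarrow> (\<Sum>i<n. norm (G (v i) - G (u i))) < e / 2"
    by (rule absolutely_continuous_fun_onE[OF G e2]) blast
  show "\<exists>\<delta>>0. \<forall>(n::nat) u v. (\<forall>i<n. a \<le> u i \<and> u i \<le> v i \<and> v i \<le> b) \<longrightarrow>
        disjoint_family_on (\<lambda>i. {u i<..<v i}) {..<n} \<longrightarrow> (\<Sum>i<n. v i - u i) < \<delta> \<longrightarrow>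
        (\<Sum>i<n. norm (F (v i) + G (v i) - (F (u i) + G (u i)))) < e"
  proof (intro exI[of _ "min d1 d2"] conjI allI impI)
    fix n :: nat and u v :: "nat \<Rightarrow> real"
    assume uv: "\<forall>i<n. a \<le> u i \<and> u i \<le> v i \<and> v i \<le> b"
      and "disjoint_family_on (\<lambda>i. {u i<..<v i}) {..<n}" "(\<Sum>i<n. v i - u i) < min d1 d2"
    then have "(\<Sum>i<n. norm (F (v i) - F (u i))) < e / 2"
      "(\<Sum>i<n. norm (G (v i) - G (u i))) < e / 2"
      by (intro d1(2) d2(2); auto)+
    moreover have "(\<Sum>i<n. norm (F (v i) + G (v i) - (F (u i) + G (u i)))) \<le>
        (\<Sum>i<n. norm (F (v i) - F (u i)) + norm (G (v i) - G (u i)))"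
      by (intro sum_mono norm_diff_triangle_ineq)
    ultimately show "(\<Sum>i<n. norm (F (v i) + G (v i) - (F (u i) + G (u i)))) < e"
      by (simp add: sum.distrib)
  qed (use d1 d2 in auto)
qed

lemma absolutely_continuous_fun_on_mult:
  assumes F: "absolutely_continuous_fun_on a b F" and G: "absolutely_continuous_fun_on a b G"
  shows "absolutely_continuous_fun_on a b (\<lambda>x. F x * G x)"
  unfolding absolutely_continuous_fun_on_def
proof (intro allI impI)
  have "bounded (F ` {a..b})" "bounded (G ` {a..b})"
    by (intro compact_imp_bounded compact_continuous_image
        absolutely_continuous_imp_continuous_on F G compact_Icc)+
  then obtain A B where A: "A > 0" "\<And>x. x \<in> {a..b} \<Longrightarrow> norm (F x) \<le> A"
    and B: "B > 0" "\<And>x. x \<in> {a..b} \<Longrightarrow> norm (G x) \<le> B"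
    unfolding bounded_pos by (metis imageI)
  fix e :: real assume "e > 0"
  \<comment> \<open>Each tolerance is divided by the bound of the other factor, since the increment
    of one factor is multiplied by a value of the other.\<close>
  then have eA: "e / (2 * A) > 0" and eB: "e / (2 * B) > 0" using A B by auto
  obtain d1 where d1: "d1 > 0"
    "\<And>(n::nat) u v. \<lbrakk>\<And>i. i < n \<Longrightarrow> a \<le> u i \<and> u i \<le> v i \<and> v i \<le> b;
       disjoint_family_on (\<lambda>i. {u i<..<v i}) {..<n}; (\<Sum>i<n. v i - u i) < d1\<rbrakk>
       \<Longrightarrow> (\<Sum>i<n. norm (F (v i) - F (u i))) < e / (2 * B)"
    by (rule absolutely_continuous_fun_onE[OF F eB]) blast
  obtain d2 where d2: "d2 > 0"
    "\<And>(n::nat) u v. \<lbrakk>\<And>i. i < n \<Longrightarrow> a \<le> u i \<and> u i \<le> v i \<and> v i \<le> b;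
       disjoint_family_on (\<lambda>i. {u i<..<v i}) {..<n}; (\<Sum>i<n. v i - u i) < d2\<rbrakk>
       \<Longrightarrow> (\<Sum>i<n. norm (G (v i) - G (u i))) < e / (2 * A)"
    by (rule absolutely_continuous_fun_onE[OF G eA]) blast
  show "\<exists>\<delta>>0. \<forall>(n::nat) u v. (\<forall>i<n. a \<le> u i \<and> u i \<le> v i \<and> v i \<le> b) \<longrightarrow>
        disjoint_family_on (\<lambda>i. {u i<..<v i}) {..<n} \<longrightarrow> (\<Sum>i<n. v i - u i) < \<delta> \<longrightarrow>
        (\<Sum>i<n. norm (F (v i) * G (v i) - F (u i) * G (u i))) < e"
  proof (intro exI[of _ "min d1 d2"] conjI allI impI)
    fix n :: nat and u v :: "nat \<Rightarrow> real"
    assume uv: "\<forall>i<n. a \<le> u i \<and> u i \<le> v i \<and> v i \<le> b"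
      and "disjoint_family_on (\<lambda>i. {u i<..<v i}) {..<n}" "(\<Sum>i<n. v i - u i) < min d1 d2"
    then have *: "(\<Sum>i<n. norm (F (v i) - F (u i))) < e / (2 * B)"
      "(\<Sum>i<n. norm (G (v i) - G (u i))) < e / (2 * A)"
      by (intro d1(2) d2(2); auto)+
    have "(\<Sum>i<n. norm (F (v i) * G (v i) - F (u i) * G (u i))) \<le>
        (\<Sum>i<n. B * norm (F (v i) - F (u i)) + A * norm (G (v i) - G (u i)))"
    proof (rule sum_mono)
      fix i assume "i \<in> {..<n}"
      then have "u i \<in> {a..b}" "v i \<in> {a..b}" using uv by force+
      then have "norm (G (v i)) \<le> B" "norm (F (u i)) \<le> A" using A B by auto
      moreover have "F (v i) * G (v i) - F (u i) * G (u i) =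
          G (v i) * (F (v i) - F (u i)) + F (u i) * (G (v i) - G (u i))"
        by (simp add: algebra_simps)
      ultimately show "norm (F (v i) * G (v i) - F (u i) * G (u i)) \<le>
          B * norm (F (v i) - F (u i)) + A * norm (G (v i) - G (u i))"
        by (auto intro!: norm_triangle_le add_mono mult_right_mono simp: norm_mult)
    qed
    also have "\<dots> = B * (\<Sum>i<n. norm (F (v i) - F (u i))) + A * (\<Sum>i<n. norm (G (v i) - G (u i)))"
      by (simp add: sum.distrib sum_distrib_left)
    also have "\<dots> < B * (e / (2 * B)) + A * (e / (2 * A))"
      using * A B by (intro add_strict_mono mult_strict_left_mono) auto
    finally show "(\<Sum>i<n. norm (F (v i) * G (v i) - F (u i) * G (u i))) < e"
      using A B by simp
  qed (use d1 d2 in auto)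
qed

text \<open>A continuous derivative is bounded on a compact interval, so \<open>F\<close> is
  Lipschitz there.\<close>

lemma absolutely_continuous_fun_on_C1:
  assumes F: "\<And>x. x \<in> {a..b} \<Longrightarrow> (F has_vector_derivative F' x) (at x within {a..b})"
    and F': "continuous_on {a..b} F'"
  shows "absolutely_continuous_fun_on a b F"
proof -
  have "bounded (F' ` {a..b})"
    by (intro compact_imp_bounded compact_continuous_image F' compact_Icc)
  then obtain B where B: "B > 0" "\<And>x. x \<in> {a..b} \<Longrightarrow> norm (F' x) \<le> B"
    unfolding bounded_pos by (metis imageI)
  have lip: "norm (F y - F x) \<le> B * norm (y - x)" if "x \<in> {a..b}" "y \<in> {a..b}" for x y
    using that B F
    by (intro differentiable_bound[of "{a..b}" F "\<lambda>x h. h *\<^sub>R F' x"])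
       (auto simp: has_vector_derivative_def intro!: onorm_le simp: mult.commute[of _ "\<bar>_\<bar>"]
         mult_left_mono)
  show ?thesis
    unfolding absolutely_continuous_fun_on_def
  proof (intro allI impI)
    fix e :: real assume "e > 0"
    show "\<exists>\<delta>>0. \<forall>(n::nat) u v. (\<forall>i<n. a \<le> u i \<and> u i \<le> v i \<and> v i \<le> b) \<longrightarrow>
        disjoint_family_on (\<lambda>i. {u i<..<v i}) {..<n} \<longrightarrow> (\<Sum>i<n. v i - u i) < \<delta> \<longrightarrow>
        (\<Sum>i<n. norm (F (v i) - F (u i))) < e"
    proof (intro exI[of _ "e / B"] conjI allI impI)
      fix n :: nat and u v :: "nat \<Rightarrow> real"
      assume uv: "\<forall>i<n. a \<le> u i \<and> u i \<le> v i \<and> v i \<le> b" and s: "(\<Sum>i<n. v i - u i) < e / B"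
      have "(\<Sum>i<n. norm (F (v i) - F (u i))) \<le> (\<Sum>i<n. B * (v i - u i))"
      proof (rule sum_mono)
        fix i assume "i \<in> {..<n}"
        then have "u i \<in> {a..b}" "v i \<in> {a..b}" "u i \<le> v i" using uv by force+
        then show "norm (F (v i) - F (u i)) \<le> B * (v i - u i)" using lip[of "u i" "v i"] by simp
      qed
      also have "\<dots> < e" using s B by (simp add: pos_less_divide_eq mult.commute flip: sum_distrib_left)
      finally show "(\<Sum>i<n. norm (F (v i) - F (u i))) < e" .
    qed (use \<open>e > 0\<close> B in auto)
  qed
qed

section \<open>The fundamental theorem of calculus for absolutely continuous functions\<close>

text \<open>This controls the exceptional set in the gauge integral. \<open>U\<close> is an open
  cover of \<open>N\<close> of measure below the \<open>d\<close> that absolute continuity assigns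
  to \<open>e\<close>; cells inside \<open>U\<close> do not overlap, so their total length is below
  \<open>d\<close>.\<close>

lemma absolutely_continuous_small_variation:
  assumes F: "absolutely_continuous_fun_on a b F" and N: "negligible N" and "e > 0"
  shows "\<exists>U. open U \<and> N \<subseteq> U \<and>
    (\<forall>p. p tagged_partial_division_of {a..b} \<longrightarrow> \<Union>(snd ` p) \<subseteq> U \<longrightarrow>
      (\<Sum>(x, K)\<in>p. norm (F (Sup K) - F (Inf K))) < e)"
proof -
  obtain d where d: "d > 0"
    "\<And>(n::nat) u v. \<lbrakk>\<And>i. i < n \<Longrightarrow> a \<le> u i \<and> u i \<le> v i \<and> v i \<le> b;
       disjoint_family_on (\<lambda>i. {u i<..<v i}) {..<n}; (\<Sum>i<n. v i - u i) < d\<rbrakk>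
       \<Longrightarrow> (\<Sum>i<n. norm (F (v i) - F (u i))) < e"
    by (rule absolutely_continuous_fun_onE[OF F \<open>e > 0\<close>]) blast
  have N0: "N \<in> null_sets lebesgue" using N by (simp add: negligible_iff_null_sets)
  obtain U where U: "open U" "N \<subseteq> U" "emeasure lebesgue (U - N) < ennreal d"
    by (rule sets_lebesgue_outer_open[OF null_setsD2[OF N0] d(1)])
  have Ud: "emeasure lebesgue U < ennreal d"
    using U N0 by (simp add: emeasure_Diff_null_set)
  then have Um: "U \<in> lmeasurable"
    using U(1) by (auto simp: fmeasurable_def intro: less_trans)
  have Ud: "measure lebesgue U < d"
    using Ud Um d(1) by (simp add: emeasure_eq_measure2 ennreal_less_iff)
  show ?thesis
  proof (intro exI[of _ U] conjI U(1,2) allI impI)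
    fix p assume p: "p tagged_partial_division_of {a..b}" and "\<Union>(snd ` p) \<subseteq> U"
    then have pU: "K \<subseteq> U" if "(x, K) \<in> p" for x K using that by force
    have "finite p" using p by (simp add: tagged_partial_division_of_def)
    then obtain t where t: "bij_betw t {..<card p} p"
      using ex_bij_betw_nat_finite[of p] by (auto simp: atLeast0LessThan)
    define u v where "u i = Inf (snd (t i))" and "v i = Sup (snd (t i))" for i
    have tp: "(fst (t i), snd (t i)) \<in> p" if "i < card p" for i
      using bij_betwE[OF t] that by auto
    have K: "snd (t i) = {u i..v i} \<and> u i \<le> v i \<and> a \<le> u i \<and> v i \<le> b" if i: "i < card p" for i
    proof -
      note * = tagged_partial_division_ofD[OF p]
      obtain w z where wz: "snd (t i) = {w..z}"
        using *(4)[OF tp[OF i]] by auto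
      moreover have "w \<le> z" using *(2)[OF tp[OF i]] wz by auto
      moreover have "{w..z} \<subseteq> {a..b}" using *(3)[OF tp[OF i]] wz by auto
      ultimately show ?thesis by (auto simp: u_def v_def)
    qed
    have disj: "disjoint_family_on (\<lambda>i. {u i<..<v i}) {..<card p}"
      unfolding disjoint_family_on_def
    proof (intro ballI impI)
      fix i j assume ij: "i \<in> {..<card p}" "j \<in> {..<card p}" "i \<noteq> j"
      then have "t i \<noteq> t j" using t by (auto simp: bij_betw_def inj_on_def)
      then have "interior (snd (t i)) \<inter> interior (snd (t j)) = {}"
        using ij by (intro tagged_partial_division_ofD(5)[OF p tp tp]) auto
      then show "{u i<..<v i} \<inter> {u j<..<v j} = {}"
        using K[of i] K[of j] ij by auto
    qed
    have "(\<Sum>i<card p. v i - u i) = (\<Sum>i<card p. measure lebesgue {u i<..<v i})"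
      using K by (intro sum.cong) (auto simp: measure_completion)
    also have "\<dots> = measure lebesgue (\<Union>i<card p. {u i<..<v i})"
      using disj K by (intro measure_finite_Union[symmetric]) auto
    also have "\<dots> \<le> measure lebesgue U"
    proof (intro measure_mono_fmeasurable Um UN_least)
      fix i assume "i \<in> {..<card p}"
      then show "{u i<..<v i} \<subseteq> U"
        using K[of i] pU[OF tp, of i] greaterThanLessThan_subseteq_atLeastAtMost_iff by auto
    qed auto
    finally have "(\<Sum>i<card p. norm (F (v i) - F (u i))) < e"
      using Ud K disj by (intro d(2)) auto
    also have "(\<Sum>i<card p. norm (F (v i) - F (u i))) = (\<Sum>(x, K)\<in>p. norm (F (Sup K) - F (Inf K)))"
      using sum.reindex_bij_betw[OF t, of "\<lambda>(x, K). norm (F (Sup K) - F (Inf K))"]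
      by (simp add: u_def v_def case_prod_unfold)
    finally show "(\<Sum>(x, K)\<in>p. norm (F (Sup K) - F (Inf K))) < e" .
  qed
qed

text \<open>Henstock's argument: at tags outside \<open>N\<close> the straddle estimate applies,
  with errors adding up to at most \<open>e1 * (b - a)\<close>; cells tagged in \<open>N\<close> are
  forced into an open set on which the increments of \<open>F\<close> have a small sum.\<close>

theorem fundamental_theorem_of_calculus_absolutely_continuous:
  assumes ab: "a \<le> b" and F: "absolutely_continuous_fun_on a b F" and N: "negligible N"
    and F': "\<And>x. x \<in> {a..b} - N \<Longrightarrow> (F has_vector_derivative F' x) (at x within {a..b})"
  shows "(F' has_integral (F b - F a)) {a..b}"
proof -
  \<comment> \<open>As \<open>g\<close> vanishes on \<open>N\<close>, a cell tagged there
    contributes only its increment of \<open>F\<close>.\<close>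
  define g where "g x = (if x \<in> N then 0 else F' x)" for x
  have "(g has_integral (F b - F a)) {a..b}"
    unfolding has_integral_real
  proof (intro allI impI)
    fix e :: real assume "e > 0"
    \<comment> \<open>The \<open>+ 1\<close> keeps the denominator positive when
      \<open>a = b\<close>.\<close>
    define e1 where "e1 = e / (2 * (b - a + 1))"
    have e1: "e1 > 0" "e1 * (b - a) < e / 2"
      using \<open>e > 0\<close> ab by (auto simp: e1_def field_simps)
    obtain U where U: "open U" "N \<subseteq> U" and
      small: "\<forall>p. p tagged_partial_division_of {a..b} \<longrightarrow> \<Union>(snd ` p) \<subseteq> U \<longrightarrow>
        (\<Sum>(x, K)\<in>p. norm (F (Sup K) - F (Inf K))) < e / 2"
      using absolutely_continuous_small_variation[OF F N half_gt_zero[OF \<open>e > 0\<close>]]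
      by (elim exE conjE)
    have "\<forall>x. \<exists>d>0. x \<in> {a..b} - N \<longrightarrow>
         (\<forall>y\<in>{a..b}. norm (y-x) < d \<longrightarrow> norm (F y - F x - (y-x) *\<^sub>R F' x) \<le> e1 * norm (y-x))"
      using F'[unfolded has_vector_derivative_def has_derivative_within_alt] e1(1) by blast
    then obtain d where d: "\<And>x. 0 < d x"
      "\<And>x y. \<lbrakk>x \<in> {a..b} - N; y \<in> {a..b}; norm (y-x) < d x\<rbrakk>
             \<Longrightarrow> norm (F y - F x - (y-x) *\<^sub>R F' x) \<le> e1 * norm (y-x)"
      by metis
    define \<gamma> where "\<gamma> x = (if x \<in> N then U else ball x (d x))" for x
    show "\<exists>\<gamma>. gauge \<gamma> \<and> (\<forall>\<D>. \<D> tagged_division_of {a..b} \<and> \<gamma> fine \<D> \<longrightarrow>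
        norm ((\<Sum>(x,k)\<in>\<D>. measure lborel k *\<^sub>R g x) - (F b - F a)) < e)"
    proof (intro exI[of _ \<gamma>] conjI allI impI)
      show "gauge \<gamma>" using U d(1) by (auto simp: gauge_def \<gamma>_def)
    next
      fix p assume "p tagged_division_of {a..b} \<and> \<gamma> fine p"
      then have p: "p tagged_division_of {a..b}" and fine: "\<gamma> fine p" by auto
      note pd = tagged_division_ofD[OF p]
      have tel: "b - a = (\<Sum>(x,K)\<in>p. Sup K - Inf K)" "F b - F a = (\<Sum>(x,K)\<in>p. F(Sup K) - F(Inf K))"
        using additive_tagged_division_1[where f= "\<lambda>x. x"] additive_tagged_division_1[where f=F]
          ab p by auto
      define q where "q = {z \<in> p. fst z \<in> N}"
      have q: "q \<subseteq> p" "finite p" "finite q" using pd(1) by (auto simp: q_def)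
      define D where "D z = measure lborel (snd z) *\<^sub>R g (fst z) - (F (Sup (snd z)) - F (Inf (snd z)))" for z
      have good: "norm (D z) \<le> e1 * (Sup (snd z) - Inf (snd z))" if "z \<in> p - q" for z
      proof -
        obtain x K where z: "z = (x, K)" by force
        then have xK: "(x, K) \<in> p" and xN: "x \<notin> N" using that by (auto simp: q_def)
        obtain u v where K: "K = {u..v}" using pd(4)[OF xK] by auto
        have x: "x \<in> {u..v}" using pd(2)[OF xK] K by auto
        have sub: "{u..v} \<subseteq> {a..b}" using pd(3)[OF xK] K by auto
        have uv: "u \<le> v" using x by auto
        have ball: "{u..v} \<subseteq> ball x (d x)" using fineD[OF fine xK] xN K by (auto simp: \<gamma>_def)
        have "u \<in> {u..v}" "v \<in> {u..v}" using uv by auto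
        then have dd: "norm (u - x) < d x" "norm (v - x) < d x" "u \<in> {a..b}" "v \<in> {a..b}" "x \<in> {a..b} - N"
          using subsetD[OF ball, of u] subsetD[OF ball, of v] sub x xN by (auto simp: dist_real_def)
        \<comment> \<open>Both endpoints are compared with the tag \<open>x\<close>, which lies
          between them, so the two distances add up to \<open>v - u\<close>.\<close>
        have "norm ((v - u) *\<^sub>R F' x - (F v - F u)) =
            norm (F u - F x - (u - x) *\<^sub>R F' x - (F v - F x - (v - x) *\<^sub>R F' x))"
          by (simp add: algebra_simps)
        also have "\<dots> \<le> e1 * norm (u - x) + e1 * norm (v - x)"
          by (intro norm_triangle_le_diff add_mono d(2) dd)
        also have "\<dots> = e1 * (v - u)"
          using x by (simp add: algebra_simps)
        finally show ?thesis
          using uv xN by (simp add: z K D_def g_def)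
      qed
      have bad: "norm (D z) = norm (F (Sup (snd z)) - F (Inf (snd z)))" if "z \<in> q" for z
        using that by (simp add: D_def g_def q_def norm_minus_commute)
      have "(\<Sum>(x,k)\<in>p. measure lborel k *\<^sub>R g x) - (F b - F a) = (\<Sum>z\<in>p. D z)"
        by (simp add: tel(2) D_def sum_subtractf case_prod_unfold)
      also have "\<dots> = (\<Sum>z\<in>p - q. D z) + (\<Sum>z\<in>q. D z)"
        using q by (intro sum.subset_diff) auto
      also have "norm \<dots> \<le> (\<Sum>z\<in>p - q. norm (D z)) + (\<Sum>z\<in>q. norm (D z))"
        by (intro norm_triangle_le add_mono norm_sum)
      also have "\<dots> < e / 2 + e / 2"
      proof (rule add_strict_mono)
        have "(\<Sum>z\<in>p - q. norm (D z)) \<le> (\<Sum>z\<in>p - q. e1 * (Sup (snd z) - Inf (snd z)))"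
          by (intro sum_mono good)
        also have "\<dots> \<le> (\<Sum>z\<in>p. e1 * (Sup (snd z) - Inf (snd z)))"
        proof (rule sum_mono2)
          fix z assume "z \<in> p - (p - q)"
          then have z: "(fst z, snd z) \<in> p" by auto
          obtain u v where "snd z = {u..v}" using pd(4)[OF z] by auto
          then show "0 \<le> e1 * (Sup (snd z) - Inf (snd z))"
            using pd(2)[OF z] e1(1) by auto
        qed (use q in auto)
        also have "\<dots> = e1 * (b - a)" by (simp add: tel(1) sum_distrib_left case_prod_unfold)
        finally show "(\<Sum>z\<in>p - q. norm (D z)) < e / 2" using e1 by simp
        have "(\<Sum>z\<in>q. norm (D z)) = (\<Sum>(x, K)\<in>q. norm (F (Sup K) - F (Inf K)))"
          by (simp add: bad case_prod_unfold)
        moreover have "(\<Sum>(x, K)\<in>q. norm (F (Sup K) - F (Inf K))) < e / 2"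
        proof (rule small[rule_format])
          show "q tagged_partial_division_of {a..b}"
            by (rule tagged_partial_division_subset[OF conjunct1[OF p[unfolded tagged_division_of_def]] q(1)])
          show "\<Union>(snd ` q) \<subseteq> U"
          proof (rule UN_least)
            fix z assume "z \<in> q"
            then have "(fst z, snd z) \<in> p" "fst z \<in> N" by (simp_all add: q_def)
            then show "snd z \<subseteq> U" using fineD[OF fine, of "fst z" "snd z"] by (simp add: \<gamma>_def)
          qed
        qed
        ultimately show "(\<Sum>z\<in>q. norm (D z)) < e / 2" by simp
      qed
      finally show "norm ((\<Sum>(x,k)\<in>p. measure lborel k *\<^sub>R g x) - (F b - F a)) < e" by simp
    qed
  qed
  then show ?thesis
    by (rule has_integral_spike[OF N, rotated]) (auto simp: g_def)
qed

lemma locally_absolutely_continuous_imp_continuous: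
  assumes "locally_absolutely_continuous F"
  shows "continuous_on UNIV F"
proof (intro continuous_at_imp_continuous_on ballI)
  fix x :: real
  have "continuous_on {x - 1..x + 1} F"
    using assms by (intro absolutely_continuous_imp_continuous_on)
      (auto simp: locally_absolutely_continuous_def)
  then have "continuous_on {x - 1<..<x + 1} F"
    by (rule continuous_on_subset) auto
  then show "isCont F x"
    by (simp add: continuous_on_eq_continuous_at)
qed

lemma locally_absolutely_continuous_mult:
  assumes "locally_absolutely_continuous F" "locally_absolutely_continuous G"
  shows "locally_absolutely_continuous (\<lambda>x. F x * G x)"
  using assms by (simp add: locally_absolutely_continuous_def absolutely_continuous_fun_on_mult)

lemma locally_absolutely_continuous_add:
  assumes "locally_absolutely_continuous F" "locally_absolutely_continuous G"
  shows "locally_absolutely_continuous (\<lambda>x. F x + G x)"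
  using assms by (simp add: locally_absolutely_continuous_def absolutely_continuous_fun_on_add)

lemma locally_absolutely_continuous_C1:
  assumes F: "\<And>x. (F has_vector_derivative F' x) (at x)" and F': "continuous_on UNIV F'"
  shows "locally_absolutely_continuous F"
  unfolding locally_absolutely_continuous_def
proof (intro allI impI)
  fix a b :: real
  show "absolutely_continuous_fun_on a b F"
    by (rule absolutely_continuous_fun_on_C1[OF has_vector_derivative_at_within[OF F]
          continuous_on_subset[OF F' subset_UNIV]])
qed

lemma fundamental_theorem_of_calculus_AE:
  assumes F: "locally_absolutely_continuous F" and "a \<le> b"
    and F': "AE x in lebesgue. (F has_vector_derivative F' x) (at x)"
  shows "(F' has_integral (F b - F a)) {a..b}"
proof (cases "a < b")
  case True
  from F' obtain N where N: "N \<in> null_sets lebesgue"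
    "{x \<in> space lebesgue. \<not> (F has_vector_derivative F' x) (at x)} \<subseteq> N"
    by (auto simp: eventually_ae_filter)
  show ?thesis
  proof (rule fundamental_theorem_of_calculus_absolutely_continuous)
    show "absolutely_continuous_fun_on a b F"
      using F True by (simp add: locally_absolutely_continuous_def)
    show "negligible N" using N by (simp add: negligible_iff_null_sets)
    fix x assume "x \<in> {a..b} - N"
    then show "(F has_vector_derivative F' x) (at x within {a..b})"
      using N by (auto intro: has_vector_derivative_at_within)
  qed fact
next
  case False
  with \<open>a \<le> b\<close> have "a = b" by simp
  then show ?thesis by (simp add: has_integral_refl)
qed

section \<open>Integrals over the whole line and decay at infinity\<close>

lemma integrable_lebesgue_imp_absolutely_integrable_on:
  fixes g :: "real \<Rightarrow> 'b::euclidean_space"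
  assumes "integrable lebesgue g"
  shows "g absolutely_integrable_on {a..b}"
proof -
  have "g absolutely_integrable_on UNIV" using assms by (simp add: set_integrable_def)
  then show ?thesis by (rule absolutely_integrable_on_subinterval) simp
qed

text \<open>Dominated convergence with majorant \<open>norm (g x)\<close>. The truth value
  \<open>P\<close>, the same for all points, treats intervals exhausting the line and intervals
  escaping to infinity together.\<close>

lemma integral_eventually_indicator_tendsto:
  fixes g :: "real \<Rightarrow> 'b::euclidean_space"
  assumes g: "integrable lebesgue g"
    and c: "\<And>x. \<forall>\<^sub>F n in sequentially. (x \<in> {a n..b n}) = P"
  shows "(\<lambda>n. integral {a n..b n} g) \<longlonglongrightarrow> (if P then LINT x|lebesgue. g x else 0)"
proof -
  have gm: "g \<in> borel_measurable lebesgue" using g by simp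
  have *: "(\<lambda>n. LINT x|lebesgue. indicator {a n..b n} x *\<^sub>R g x) \<longlonglongrightarrow>
    (LINT x|lebesgue. (if P then g x else 0))"
  proof (rule integral_dominated_convergence[where w="\<lambda>x. norm (g x)"])
    show "AE x in lebesgue. (\<lambda>n. indicator {a n..b n} x *\<^sub>R g x) \<longlonglongrightarrow> (if P then g x else 0)"
    proof (rule AE_I2)
      fix x
      show "(\<lambda>n. indicator {a n..b n} x *\<^sub>R g x) \<longlonglongrightarrow> (if P then g x else 0)"
        by (rule tendsto_eventually, rule eventually_mono[OF c[of x]]) (auto simp: indicator_def)
    qed
    show "(\<lambda>x. indicator {a n..b n} x *\<^sub>R g x) \<in> borel_measurable lebesgue" for n
      using gm by (intro borel_measurable_scaleR borel_measurable_indicator) auto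
  qed (use g gm in \<open>auto simp: indicator_def\<close>)
  have "(LINT x|lebesgue. indicator {a n..b n} x *\<^sub>R g x) = integral {a n..b n} g" for n
    using set_lebesgue_integral_eq_integral(2)[OF integrable_lebesgue_imp_absolutely_integrable_on[OF g], of "a n" "b n"]
    by (simp add: set_lebesgue_integral_def)
  with * show ?thesis by (cases P) simp_all
qed

lemma integral_exhausting_tendsto:
  fixes g :: "real \<Rightarrow> 'b::euclidean_space"
  assumes "integrable lebesgue g"
    and a: "filterlim a at_bot sequentially" and b: "filterlim b at_top sequentially"
  shows "(\<lambda>n. integral {a n..b n} g) \<longlonglongrightarrow> (LINT x|lebesgue. g x)"
proof -
  have "\<forall>\<^sub>F n in sequentially. (x \<in> {a n..b n}) = True" for x
    using filterlim_at_bot[THEN iffD1, OF a, rule_format, of x]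
      filterlim_at_top[THEN iffD1, OF b, rule_format, of x]
    by eventually_elim auto
  from integral_eventually_indicator_tendsto[OF assms(1) this] show ?thesis by simp
qed

lemma integral_escaping_tendsto:
  fixes g :: "real \<Rightarrow> 'b::euclidean_space"
  assumes "integrable lebesgue g" and a: "filterlim (\<lambda>n. \<bar>a n\<bar>) at_top sequentially"
  shows "(\<lambda>n. integral {a n..a n + 1} g) \<longlonglongrightarrow> 0"
proof -
  have "\<forall>\<^sub>F n in sequentially. (x \<in> {a n..a n + 1}) = False" for x
    using filterlim_at_top[THEN iffD1, OF a, rule_format, of "\<bar>x\<bar> + 2"]
    by eventually_elim auto
  from integral_eventually_indicator_tendsto[OF assms(1) this] show ?thesis by simp
qed

text \<open>On \<open>{x..x + 1}\<close> the function departs from \<open>F x\<close> by at most the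
  integral of \<open>norm (F' y)\<close>. Averaging bounds \<open>norm (F x)\<close> by the integral
  of \<open>G\<close> over this interval, which vanishes as the interval escapes to
  infinity.\<close>

lemma absolutely_continuous_tendsto_0:
  assumes F: "locally_absolutely_continuous F"
    and F': "AE x in lebesgue. (F has_vector_derivative F' x) (at x)"
    and int: "integrable lebesgue F" "integrable lebesgue F'"
    and a: "filterlim (\<lambda>n. \<bar>a n\<bar>) at_top sequentially"
  shows "(\<lambda>n. F (a n)) \<longlonglongrightarrow> 0"
proof (rule Lim_null_comparison)
  define G where "G x = norm (F x) + norm (F' x)" for x
  have G: "integrable lebesgue G" unfolding G_def using int by simp
  show "(\<lambda>n. integral {a n..a n + 1} G) \<longlonglongrightarrow> 0"
    by (rule integral_escaping_tendsto[OF G a])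
  have "norm (F x) \<le> integral {x..x + 1} G" for x
  proof -
    define C where "C = integral {x..x + 1} (\<lambda>y. norm (F' y))"
    note ai = integrable_lebesgue_imp_absolutely_integrable_on
    have iF: "(\<lambda>y. norm (F y)) integrable_on {x..x+1}" and iF': "(\<lambda>y. norm (F' y)) integrable_on {x..z}" for z
      using ai[OF int(1)] ai[OF int(2)] by (auto simp: absolutely_integrable_on_def)
    have bound: "norm (F x) \<le> norm (F y) + C" if y: "y \<in> {x..x + 1}" for y
    proof -
      have *: "(F' has_integral (F y - F x)) {x..y}"
        using y by (intro fundamental_theorem_of_calculus_AE F F') auto
      have "norm (F y - F x) \<le> integral {x..y} (\<lambda>y. norm (F' y))"
        using has_integral_integrable[OF *] integral_unique[OF *] iF'
          integral_norm_bound_integral[of F' "{x..y}" "\<lambda>y. norm (F' y)"] by simp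
      also have "\<dots> \<le> C"
        unfolding C_def using y iF' by (intro integral_subset_le) auto
      finally show ?thesis
        using norm_triangle_ineq2[of "F x" "F y"] by (simp add: norm_minus_commute)
    qed
    \<comment> \<open>The interval has length 1, so constants equal their own integrals.\<close>
    have "integral {x..x + 1} (\<lambda>y. norm (F x)) \<le> integral {x..x + 1} (\<lambda>y. norm (F y) + C)"
      by (intro integral_le integrable_add iF bound integrable_const_ivl)
    also have "\<dots> = integral {x..x + 1} (\<lambda>y. norm (F y)) + C"
      using iF by (subst integral_add) auto
    also have "\<dots> = integral {x..x + 1} G"
      unfolding C_def G_def using iF iF' by (subst integral_add) auto
    finally show ?thesis by simp
  qed
  then show "\<forall>\<^sub>F n in sequentially. norm (F (a n)) \<le> integral {a n..a n + 1} G"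
    by simp
qed

text \<open>The integral over a symmetric interval is the difference of two boundary values, and
  both tend to 0.\<close>

lemma absolutely_continuous_integral_derivative_eq_0:
  assumes F: "locally_absolutely_continuous F"
    and F': "AE x in lebesgue. (F has_vector_derivative F' x) (at x)"
    and int: "integrable lebesgue F" "integrable lebesgue F'"
  shows "(LINT x|lebesgue. F' x) = 0"
proof (rule LIMSEQ_unique)
  show "(\<lambda>n. integral {- real n..real n} F') \<longlonglongrightarrow> (LINT x|lebesgue. F' x)"
    by (rule integral_exhausting_tendsto[OF int(2)])
       (auto simp: filterlim_uminus_at_bot filterlim_real_sequentially)
  have "integral {- real n..real n} F' = F (real n) - F (- real n)" for n
    by (intro integral_unique fundamental_theorem_of_calculus_AE F F') simp
  moreover have "(\<lambda>n. F (real n) - F (- real n)) \<longlonglongrightarrow> 0 - 0"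
    by (intro tendsto_diff absolutely_continuous_tendsto_0[OF F F' int])
       (simp_all add: filterlim_real_sequentially)
  ultimately show "(\<lambda>n. integral {- real n..real n} F') \<longlonglongrightarrow> 0" by simp
qed

section \<open>Fourier integrals of derivatives\<close>

lemma integrable_lebesgue_mult_bounded_continuous:
  fixes g w :: "real \<Rightarrow> complex"
  assumes g: "integrable lebesgue g" and w: "continuous_on UNIV w" "\<And>x. norm (w x) \<le> B"
  shows "integrable lebesgue (\<lambda>x. g x * w x)"
proof (rule Bochner_Integration.integrable_bound)
  show "integrable lebesgue (\<lambda>x. B * norm (g x))" using g by simp
  have "w \<in> borel_measurable lebesgue"
    using w(1) by (intro measurable_completion) (simp add: borel_measurable_continuous_onI)
  then show "(\<lambda>x. g x * w x) \<in> borel_measurable lebesgue" using g by simp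
  show "AE x in lebesgue. norm (g x * w x) \<le> norm (B * norm (g x))"
  proof (rule AE_I2)
    fix x
    have "norm (g x) * norm (w x) \<le> norm (g x) * B" by (intro mult_left_mono w) simp
    also have "\<dots> \<le> norm (B * norm (g x))" by (simp add: abs_mult mult.commute mult_right_mono)
    finally show "norm (g x * w x) \<le> norm (B * norm (g x))" by (simp add: norm_mult)
  qed
qed

lemma has_vector_derivative_cis_mult:
  "((\<lambda>x. cis (w * x)) has_vector_derivative \<i> * of_real w * cis (w * x)) (at x within S)"
  unfolding has_vector_derivative_def
  by (rule has_derivative_eq_rhs, rule has_derivative_cis[of "\<lambda>x. w * x"])
     (auto intro!: derivative_eq_intros simp: fun_eq_iff scaleR_conv_of_real)

text \<open>Integration by parts: \<open>F x * cis (w * x)\<close> and its derivative are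
  integrable, so the derivative has integral 0 over the line.\<close>

lemma integral_derivative_cis:
  assumes F: "locally_absolutely_continuous F"
    and F': "AE x in lebesgue. (F has_vector_derivative F' x) (at x)"
    and int: "integrable lebesgue F" "integrable lebesgue F'"
  shows "(LINT x|lebesgue. F' x * cis (w * x)) = - \<i> * of_real w * (LINT x|lebesgue. F x * cis (w * x))"
proof -
  have i: "integrable lebesgue (\<lambda>x. F x * cis (w * x))" "integrable lebesgue (\<lambda>x. F' x * cis (w * x))"
    by (intro integrable_lebesgue_mult_bounded_continuous[where B=1] int continuous_intros; simp)+
  have "0 = (LINT x|lebesgue. F' x * cis (w * x) + \<i> * of_real w * (F x * cis (w * x)))"
  proof (rule absolutely_continuous_integral_derivative_eq_0[symmetric])
    show "locally_absolutely_continuous (\<lambda>x. F x * cis (w * x))"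
      by (intro locally_absolutely_continuous_mult F
          locally_absolutely_continuous_C1[OF has_vector_derivative_cis_mult] continuous_intros)
    show "AE x in lebesgue. ((\<lambda>x. F x * cis (w * x)) has_vector_derivative
        F' x * cis (w * x) + \<i> * of_real w * (F x * cis (w * x))) (at x)"
      using F'
    proof eventually_elim
      case (elim x)
      show ?case
        using has_vector_derivative_mult[OF elim has_vector_derivative_cis_mult[of w x UNIV]]
        by (simp add: algebra_simps)
    qed
    show "integrable lebesgue (\<lambda>x. F x * cis (w * x))" by (rule i(1))
    show "integrable lebesgue (\<lambda>x. F' x * cis (w * x) + \<i> * of_real w * (F x * cis (w * x)))"
      by (intro Bochner_Integration.integrable_add integrable_mult_right i)
  qed
  also have "(LINT x|lebesgue. F' x * cis (w * x) + \<i> * of_real w * (F x * cis (w * x))) =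
      (LINT x|lebesgue. F' x * cis (w * x)) + \<i> * of_real w * (LINT x|lebesgue. F x * cis (w * x))"
    by (subst Bochner_Integration.integral_add[OF i(2) integrable_mult_right[OF i(1)]]) simp
  finally show ?thesis by (simp add: add_eq_0_iff)
qed

section \<open>The Fourier series of the second Bernoulli polynomial\<close>

text \<open>The factor \<open>2 * sin (x / 2)\<close> makes the cosine sum telescope; keeping it on
  the left avoids a division where it vanishes.\<close>

lemma dirichlet_kernel:
  fixes x :: real
  shows "2 * sin (x / 2) * (1 / 2 + (\<Sum>k<N. cos (real (Suc k) * x))) = sin ((real N + 1 / 2) * x)"
proof (induction N)
  case (Suc N)
  define a where "a = real (Suc N) * x"
  have "(real (Suc N) + 1 / 2) * x = a + x / 2" "(real N + 1 / 2) * x = a - x / 2"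
    by (simp_all add: a_def algebra_simps)
  then have "2 * sin (x / 2) * cos a = sin ((real (Suc N) + 1 / 2) * x) - sin ((real N + 1 / 2) * x)"
    by (simp add: sin_add sin_diff)
  with Suc show ?case by (simp add: algebra_simps a_def)
qed simp

text \<open>A quantitative sawtooth Fourier series away from the jumps. The derivative of
  \<open>E\<close> is minus the Dirichlet kernel; \<open>H\<close> removes the leading part of its
  primitive, so that the derivative of \<open>H\<close> is of order \<open>1 / c\<close>, and
  \<open>H pi = 0\<close> anchors the estimate.\<close>

lemma sawtooth_remainder_bound:
  fixes x \<delta> :: real
  assumes \<delta>: "0 < \<delta>" "\<delta> \<le> pi" and x: "x \<in> {\<delta>..2 * pi - \<delta>}"
  shows "\<bar>(pi - x) / 2 - (\<Sum>k<N. sin (real (Suc k) * x) / real (Suc k))\<bar> \<le>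
    (pi / (sin (\<delta> / 2))\<^sup>2 + 1 / sin (\<delta> / 2)) / (2 * real N + 1)"
proof -
  define s where "s = sin (\<delta> / 2)"
  define c where "c = 2 * real N + 1"
  define E where "E y = (pi - y) / 2 - (\<Sum>k<N. sin (real (Suc k) * y) / real (Suc k))" for y :: real
  \<comment> \<open>The correction is an antiderivative of the oscillating part of \<open>E'\<close> up to \<open>O(1/N)\<close>.\<close>
  define H where "H y = E y - cos (c / 2 * y) / (c * sin (y / 2))" for y :: real
  have s: "s > 0" using \<delta> by (auto simp: s_def intro: sin_gt_zero)
  have c: "c \<ge> 1" by (simp add: c_def)
  \<comment> \<open>The interval and \<open>sin (y / 2)\<close> are both symmetric about
    \<open>pi\<close>, so the minimum is attained at the endpoints.\<close>
  have sy: "sin (y / 2) \<ge> s" if "y \<in> {\<delta>..2 * pi - \<delta>}" for y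
  proof (cases "y \<le> pi")
    case True
    then show ?thesis using that \<delta> unfolding s_def by (intro sin_monotone_2pi_le) auto
  next
    case False
    have "sin (\<delta> / 2) \<le> sin (pi - y / 2)"
      using False that \<delta> by (intro sin_monotone_2pi_le) auto
    then show ?thesis by (simp add: s_def)
  qed
  have E': "(E has_real_derivative - (1 / 2 + (\<Sum>k<N. cos (real (Suc k) * y)))) (at y)" for y
    unfolding E_def by (rule derivative_eq_intros refl | simp)+
  have H': "(H has_real_derivative cos (c / 2 * y) * cos (y / 2) / (2 * c * (sin (y / 2))\<^sup>2)) (at y)"
    if "y \<in> {\<delta>..2 * pi - \<delta>}" for y
  proof -
    have y0: "sin (y / 2) > 0" using sy[OF that] s by simp
    define P where "P = 1 / 2 + (\<Sum>k<N. cos (real (Suc k) * y))"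
    have P: "P = sin (c / 2 * y) / (2 * sin (y / 2))"
      using dirichlet_kernel[of y N] y0 by (simp add: field_simps c_def P_def)
    have "((\<lambda>y. cos (c / 2 * y) / (c * sin (y / 2))) has_real_derivative
        (- sin (c / 2 * y) * (c / 2) * (c * sin (y / 2)) - cos (c / 2 * y) * (c * (cos (y / 2) / 2))) /
        (c * sin (y / 2) * (c * sin (y / 2)))) (at y)"
      using y0 c by (auto intro!: derivative_eq_intros)
    then have "(H has_real_derivative - P - (- sin (c / 2 * y) * (c / 2) * (c * sin (y / 2)) -
        cos (c / 2 * y) * (c * (cos (y / 2) / 2))) / (c * sin (y / 2) * (c * sin (y / 2)))) (at y)"
      unfolding H_def P_def by (intro DERIV_diff E')
    then show ?thesis
      by (rule DERIV_cong) (use y0 c in \<open>simp add: P field_simps power2_eq_square\<close>)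
  qed
  have "norm (H x - H pi) \<le> 1 / (2 * c * s\<^sup>2) * norm (x - pi)"
  proof (rule field_differentiable_bound[of "{\<delta>..2 * pi - \<delta>}"])
    fix y assume y: "y \<in> {\<delta>..2 * pi - \<delta>}"
    then show "(H has_field_derivative cos (c / 2 * y) * cos (y / 2) / (2 * c * (sin (y / 2))\<^sup>2))
        (at y within {\<delta>..2 * pi - \<delta>})"
      using H' has_field_derivative_at_within by blast
    have "\<bar>cos (c / 2 * y) * cos (y / 2)\<bar> \<le> 1 * 1"
      unfolding abs_mult by (intro mult_mono) auto
    moreover have "2 * c * s\<^sup>2 \<le> 2 * c * (sin (y / 2))\<^sup>2"
      using sy[OF y] s c by (intro mult_left_mono power_mono) auto
    ultimately have "\<bar>cos (c / 2 * y) * cos (y / 2)\<bar> / (2 * c * (sin (y / 2))\<^sup>2) \<le> 1 / (2 * c * s\<^sup>2)"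
      using c s by (intro frac_le) auto
    then show "norm (cos (c / 2 * y) * cos (y / 2) / (2 * c * (sin (y / 2))\<^sup>2)) \<le> 1 / (2 * c * s\<^sup>2)"
      using c by (simp add: abs_mult)
  qed (use x \<delta> in auto)
  also have "\<dots> \<le> 1 / (2 * c * s\<^sup>2) * pi"
    using x \<delta> c s by (intro mult_left_mono) auto
  also have "\<dots> \<le> pi / (c * s\<^sup>2)"
    using c s by (simp add: field_simps)
  finally have 1: "\<bar>H x - H pi\<bar> \<le> pi / (c * s\<^sup>2)" by simp
  \<comment> \<open>\<open>c\<close> is odd, so the argument is an odd multiple of
    \<open>pi / 2\<close>.\<close>
  have "cos (c / 2 * pi) = 0"
    unfolding cos_zero_iff_int by (rule exI[of _ "2 * int N + 1"]) (simp add: c_def)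
  moreover have "sin (real (Suc k) * pi) = 0" for k
    by (rule sin_npi)
  ultimately have Hpi: "H pi = 0"
    by (simp add: H_def E_def)
  have "\<bar>cos (c / 2 * x) / (c * sin (x / 2))\<bar> \<le> 1 / (c * s)"
    using sy[OF x] s c by (auto simp: abs_mult intro!: frac_le mult_left_mono)
  then have "\<bar>E x\<bar> \<le> pi / (c * s\<^sup>2) + 1 / (c * s)"
    using 1 abs_triangle_ineq[of "H x" "E x - H x"] Hpi by (simp add: H_def)
  also have "\<dots> = (pi / s\<^sup>2 + 1 / s) / c"
    using c s by (simp add: field_simps)
  finally show ?thesis by (simp add: E_def c_def s_def)
qed

lemma summable_inverse_Suc_squares: "summable (\<lambda>n. 1 / real (Suc n) ^ 2)"
  using inverse_squares_sums by (simp add: sums_iff add.commute)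

text \<open>The derivative of \<open>g N\<close> is the negated sawtooth remainder, which tends to 0
  uniformly on compact parts of the open interval. Hence the limit \<open>T\<close> is constant
  there, and up to the endpoints by continuity; \<open>T 0 = 0\<close> is the Basel sum.\<close>

lemma cos_squares_series_sums:
  fixes x :: real
  assumes x: "x \<in> {0..2 * pi}"
  shows "(\<lambda>k. cos (real (Suc k) * x) / real (Suc k) ^ 2) sums (x\<^sup>2 / 4 - pi * x / 2 + pi\<^sup>2 / 6)"
proof -
  define g where "g N y = y\<^sup>2 / 4 - pi * y / 2 + pi\<^sup>2 / 6 - (\<Sum>k<N. cos (real (Suc k) * y) / real (Suc k) ^ 2)"
    for N and y :: real
  have uc: "uniform_limit UNIV (\<lambda>N y. \<Sum>k<N. cos (real (Suc k) * y) / real (Suc k) ^ 2)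
      (\<lambda>y. \<Sum>k. cos (real (Suc k) * y) / real (Suc k) ^ 2) sequentially"
    by (rule Weierstrass_m_test[OF _ summable_inverse_Suc_squares])
       (auto simp: divide_right_mono)
  define T where "T y = y\<^sup>2 / 4 - pi * y / 2 + pi\<^sup>2 / 6 - (\<Sum>k. cos (real (Suc k) * y) / real (Suc k) ^ 2)"
    for y :: real
  have gT: "(\<lambda>N. g N y) \<longlonglongrightarrow> T y" for y
    unfolding g_def T_def by (intro tendsto_intros tendsto_uniform_limitI[OF uc]) auto
  have "continuous_on UNIV (\<lambda>y. \<Sum>k. cos (real (Suc k) * y) / real (Suc k) ^ 2)"
    by (rule uniform_limit_theorem[OF _ uc]) (auto intro!: always_eventually continuous_intros)
  then have contT: "continuous_on UNIV T"
    unfolding T_def by (intro continuous_intros) auto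
  have Teq: "T y = T pi" if y: "y \<in> {0<..<2 * pi}" for y
  proof -
    \<comment> \<open>One interval is to contain both \<open>y\<close> and the reference point
      \<open>pi\<close>.\<close>
    define \<delta> where "\<delta> = min y (2 * pi - y)"
    define C where "C = pi / (sin (\<delta> / 2))\<^sup>2 + 1 / sin (\<delta> / 2)"
    have \<delta>: "0 < \<delta>" "\<delta> \<le> pi" "y \<in> {\<delta>..2 * pi - \<delta>}" "pi \<in> {\<delta>..2 * pi - \<delta>}"
      using y by (auto simp: \<delta>_def min_def)
    have bound: "norm (g N y - g N pi) \<le> C / (2 * real N + 1) * norm (y - pi)" for N
    proof (rule field_differentiable_bound[of "{\<delta>..2 * pi - \<delta>}" "g N"
          "\<lambda>z. - ((pi - z) / 2 - (\<Sum>k<N. sin (real (Suc k) * z) / real (Suc k)))"])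
      fix z assume z: "z \<in> {\<delta>..2 * pi - \<delta>}"
      have "((\<lambda>z. cos (real (Suc k) * z) / real (Suc k) ^ 2) has_real_derivative
          - (sin (real (Suc k) * z) / real (Suc k))) (at z within {\<delta>..2 * pi - \<delta>})" for k
        by (rule derivative_eq_intros refl | simp add: power2_eq_square)+
      then have "(g N has_real_derivative z / 2 - pi / 2 - (\<Sum>k<N. - (sin (real (Suc k) * z) / real (Suc k))))
          (at z within {\<delta>..2 * pi - \<delta>})"
        unfolding g_def
        by (intro DERIV_diff DERIV_sum) (auto intro!: derivative_eq_intros)
      then show "(g N has_real_derivative - ((pi - z) / 2 - (\<Sum>k<N. sin (real (Suc k) * z) / real (Suc k))))
          (at z within {\<delta>..2 * pi - \<delta>})"
        by (rule DERIV_cong) (simp add: sum_negf field_simps)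
      show "norm (- ((pi - z) / 2 - (\<Sum>k<N. sin (real (Suc k) * z) / real (Suc k)))) \<le> C / (2 * real N + 1)"
        using sawtooth_remainder_bound[OF \<delta>(1,2) z, of N] by (simp add: C_def)
    qed (use \<delta> in auto)
    have "(\<lambda>N. C / (2 * real N + 1) * norm (y - pi)) \<longlonglongrightarrow> 0"
      by real_asymp
    then have "(\<lambda>N. g N y - g N pi) \<longlonglongrightarrow> 0"
      by (rule Lim_null_comparison[rotated]) (intro always_eventually allI bound)
    moreover have "(\<lambda>N. g N y - g N pi) \<longlonglongrightarrow> T y - T pi"
      by (intro tendsto_diff gT)
    ultimately show ?thesis using LIMSEQ_unique by fastforce
  qed
  have T0: "T 0 = 0"
    using inverse_squares_sums by (simp add: T_def sums_iff add.commute)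
  have Tconst: "T y = T pi" if "y \<in> {0..2 * pi}" for y
  proof (rule continuous_constant_on_closure[of "{0<..<2 * pi}" T])
    show "continuous_on (closure {0<..<2 * pi}) T"
      by (rule continuous_on_subset[OF contT]) simp
    show "y \<in> closure {0<..<2 * pi}"
      using that by (simp add: closure_greaterThanLessThan)
  qed (rule Teq)
  have "T x = 0" using Tconst[OF x] Tconst[of 0] T0 by simp
  moreover have "(\<lambda>k. cos (real (Suc k) * x) / real (Suc k) ^ 2) sums
      (\<Sum>k. cos (real (Suc k) * x) / real (Suc k) ^ 2)"
    unfolding sums_def by (rule tendsto_uniform_limitI[OF uc]) simp
  ultimately show ?thesis by (simp add: T_def)
qed

section \<open>The Euler-Maclaurin formula\<close>

text \<open>These are the positive multiples of \<open>\<sigma> = 2 * pi / h\<close>;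
  \<open>Suc\<close> skips the zero frequency, which stands for the integral itself.\<close>

definition quadrature_freq :: "real \<Rightarrow> nat \<Rightarrow> real" where
  "quadrature_freq h k = 2 * pi * real (Suc k) / h"

text \<open>The series is periodic without mention of fractional parts and ready for termwise
  integration; the polynomial form is recovered cell by cell.\<close>

definition quadrature_kernel :: "real \<Rightarrow> real \<Rightarrow> real" where
  "quadrature_kernel h x = (\<Sum>k. 2 * cos (quadrature_freq h k * x) / (quadrature_freq h k)\<^sup>2)"

lemma quadrature_kernel_sums_on_cell:
  fixes n :: int and h x :: real
  assumes h: "h > 0" and x: "x \<in> {h * n..h * (n + 1)}"
  shows "(\<lambda>k. 2 * cos (quadrature_freq h k * x) / (quadrature_freq h k)\<^sup>2) sums
    (h\<^sup>2 * ((x / h - n)\<^sup>2 - (x / h - n) + 1 / 6) / 2)"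
proof -
  define t where "t = x / h - n"
  have t: "2 * pi * t \<in> {0..2 * pi}"
  proof -
    have "0 \<le> t" "t \<le> 1" using x h by (auto simp: t_def field_simps)
    then show ?thesis by (simp add: mult_left_le)
  qed
  have "cos (quadrature_freq h k * x) = cos (real (Suc k) * (2 * pi * t))" for k
  proof -
    \<comment> \<open>Passing from \<open>x / h\<close> to its position \<open>t\<close> in the cell
      shifts the phase by an integer multiple of \<open>2 * pi\<close>.\<close>
    have "quadrature_freq h k * x = real (Suc k) * (2 * pi * t) + 2 * pi * of_int (int (Suc k) * n)"
      using h by (simp add: quadrature_freq_def t_def field_simps)
    then show ?thesis by (simp add: cos_add del: of_int_mult)
  qed
  then have "2 * cos (quadrature_freq h k * x) / (quadrature_freq h k)\<^sup>2 =
      h\<^sup>2 / (2 * pi\<^sup>2) * (cos (real (Suc k) * (2 * pi * t)) / real (Suc k) ^ 2)" for k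
    by (simp add: quadrature_freq_def power_mult_distrib power_divide)
  moreover have "(\<lambda>k. h\<^sup>2 / (2 * pi\<^sup>2) * (cos (real (Suc k) * (2 * pi * t)) / real (Suc k) ^ 2)) sums
      (h\<^sup>2 / (2 * pi\<^sup>2) * ((2 * pi * t)\<^sup>2 / 4 - pi * (2 * pi * t) / 2 + pi\<^sup>2 / 6))"
    by (intro sums_mult cos_squares_series_sums t)
  moreover have "h\<^sup>2 / (2 * pi\<^sup>2) * ((2 * pi * t)\<^sup>2 / 4 - pi * (2 * pi * t) / 2 + pi\<^sup>2 / 6) =
      h\<^sup>2 * (t\<^sup>2 - t + 1 / 6) / 2"
    by (simp add: power2_eq_square field_simps)
  ultimately show ?thesis by (simp only: t_def)
qed

text \<open>The kernel is \<open>h\<^sup>2 B\<^sub>2({x/h}) / 2\<close>, so integrating by parts twice on each cell produces the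
  trapezoidal rule; the boundary terms of consecutive cells cancel.\<close>
lemma quadrature_cell:
  fixes n :: int and h :: real
  assumes h: "h > 0"
    and F: "\<And>x. (F has_vector_derivative F' x) (at x)"
    and F': "locally_absolutely_continuous F'"
    and G: "AE x in lebesgue. (F' has_vector_derivative G x) (at x)"
  shows "((\<lambda>x. G x * of_real (quadrature_kernel h x) - F x) has_integral
    of_real (h\<^sup>2 / 12) * (F' (h * (n + 1)) - F' (h * n)) -
    of_real (h / 2) * (F (h * (n + 1)) + F (h * n))) {h * n..h * (n + 1)}"
proof -
  define t where "t x = x / h - n" for x :: real
  \<comment> \<open>On the cell \<open>p\<close> is the kernel, with derivative \<open>- q\<close>,
    and \<open>q\<close> has derivative \<open>- 1\<close>. In the derivative of \<open>W\<close>
    the terms \<open>F' x * q x\<close> therefore cancel and \<open>G x * p x - F x\<close>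
    remains.\<close>
  define p where "p x = complex_of_real (h\<^sup>2 * ((t x)\<^sup>2 - t x + 1 / 6) / 2)" for x
  define q where "q x = complex_of_real (- h * (t x - 1 / 2))" for x
  define W where "W x = F' x * p x + F x * q x" for x
  have p: "(p has_vector_derivative - q x) (at x)" for x
  proof -
    have "((\<lambda>x. h\<^sup>2 * ((x / h - n)\<^sup>2 - (x / h - n) + 1 / 6) / 2) has_real_derivative h * (x / h - n - 1 / 2)) (at x)"
      using h by (auto intro!: derivative_eq_intros simp: power2_eq_square field_simps)
    then have "((\<lambda>x. complex_of_real (h\<^sup>2 * ((x / h - n)\<^sup>2 - (x / h - n) + 1 / 6) / 2)) has_vector_derivative
        complex_of_real (h * (x / h - n - 1 / 2))) (at x)"
      by (rule has_vector_derivative_of_real)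
    then show ?thesis by (simp add: p_def[abs_def] q_def t_def)
  qed
  have q: "(q has_vector_derivative - 1) (at x)" for x
  proof -
    have "((\<lambda>x. - h * (x / h - n - 1 / 2)) has_real_derivative - 1) (at x)"
      using h by (auto intro!: derivative_eq_intros)
    then have "((\<lambda>x. complex_of_real (- h * (x / h - n - 1 / 2))) has_vector_derivative complex_of_real (- 1)) (at x)"
      by (rule has_vector_derivative_of_real)
    then show ?thesis by (simp add: q_def[abs_def] t_def)
  qed
  have contq: "continuous_on UNIV q"
    unfolding q_def t_def using h by (intro continuous_intros) auto
  have contF': "continuous_on UNIV F'"
    by (rule locally_absolutely_continuous_imp_continuous[OF F'])
  have "((\<lambda>x. G x * p x - F x) has_integral (W (h * (n + 1)) - W (h * n))) {h * n..h * (n + 1)}"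
  proof (rule fundamental_theorem_of_calculus_AE)
    show "locally_absolutely_continuous W"
      unfolding W_def
      by (intro locally_absolutely_continuous_add locally_absolutely_continuous_mult F'
          locally_absolutely_continuous_C1[OF p] locally_absolutely_continuous_C1[OF q]
          locally_absolutely_continuous_C1[OF F] contF' contq continuous_intros)
    show "h * n \<le> h * (n + 1)" using h by simp
    show "AE x in lebesgue. (W has_vector_derivative G x * p x - F x) (at x)"
      using G
    proof eventually_elim
      case (elim x)
      show ?case
        unfolding W_def
        by (rule has_vector_derivative_add[OF has_vector_derivative_mult[OF elim p]
              has_vector_derivative_mult[OF F q], THEN has_vector_derivative_eq_rhs])
           (simp add: algebra_simps)
    qed
  qed
  moreover have "p x = of_real (quadrature_kernel h x)" if "x \<in> {h * n..h * (n + 1)}" for x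
    by (simp only: p_def t_def quadrature_kernel_def
        sums_unique[OF quadrature_kernel_sums_on_cell[OF h that]])
  \<comment> \<open>The second Bernoulli polynomial is \<open>1 / 6\<close> at both 0 and 1, so
    \<open>p\<close> is \<open>h\<^sup>2 / 12\<close> at both ends, while \<open>q\<close> changes
    from \<open>h / 2\<close> to \<open>- h / 2\<close>.\<close>
  moreover have "W (h * (n + 1)) - W (h * n) =
    of_real (h\<^sup>2 / 12) * (F' (h * (n + 1)) - F' (h * n)) -
    of_real (h / 2) * (F (h * (n + 1)) + F (h * n))"
  proof -
    have "t (h * (n + 1)) = 1" "t (h * n) = 0" using h by (simp_all add: t_def field_simps)
    then show ?thesis by (simp add: W_def p_def q_def algebra_simps)
  qed
  ultimately show ?thesis
    by (subst has_integral_cong[where g = "\<lambda>x. G x * p x - F x"]) simp_all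
qed

text \<open>Each induction step adds one cell at either end. Cells give the two outermost nodes only
  the weight \<open>h / 2\<close>; the term in \<open>F (h * real N) + F (- h * real N)\<close>
  makes up for counting them fully in the sum.\<close>

lemma quadrature_symmetric_range:
  assumes h: "h > 0"
    and F: "\<And>x. (F has_vector_derivative F' x) (at x)"
    and F': "locally_absolutely_continuous F'"
    and G: "AE x in lebesgue. (F' has_vector_derivative G x) (at x)"
  shows "((\<lambda>x. G x * of_real (quadrature_kernel h x) - F x) has_integral
    of_real (h\<^sup>2 / 12) * (F' (h * real N) - F' (- h * real N)) +
    of_real (h / 2) * (F (h * real N) + F (- h * real N)) -
    of_real h * (\<Sum>k\<in>{- int N..int N}. F (h * of_int k))) {- h * real N..h * real N}"
proof (induction N)
  case 0
  then show ?case by (simp add: has_integral_refl)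
next
  case (Suc N)
  have set: "{- int (Suc N)..int (Suc N)} = insert (- int (Suc N)) (insert (int (Suc N)) {- int N..int N})"
    by auto
  have sum: "(\<Sum>k\<in>{- int (Suc N)..int (Suc N)}. F (h * of_int k)) =
      F (- h * real (Suc N)) + (F (h * real (Suc N)) + (\<Sum>k\<in>{- int N..int N}. F (h * of_int k)))"
    unfolding set by (subst sum.insert; simp add: minus_mult_right)+
  have le: "- h * real (Suc N) \<le> - h * real N" "- h * real N \<le> h * real (Suc N)"
    "- h * real N \<le> h * real N" "h * real N \<le> h * real (Suc N)"
    using h by (auto simp: algebra_simps)
  have L: "((\<lambda>x. G x * of_real (quadrature_kernel h x) - F x) has_integral
    of_real (h\<^sup>2 / 12) * (F' (- h * real N) - F' (- h * real (Suc N))) -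
    of_real (h / 2) * (F (- h * real N) + F (- h * real (Suc N)))) {- h * real (Suc N)..- h * real N}"
    using quadrature_cell[OF h F F' G, of "- int (Suc N)"] by (simp add: algebra_simps)
  have R: "((\<lambda>x. G x * of_real (quadrature_kernel h x) - F x) has_integral
    of_real (h\<^sup>2 / 12) * (F' (h * real (Suc N)) - F' (h * real N)) -
    of_real (h / 2) * (F (h * real (Suc N)) + F (h * real N))) {h * real N..h * real (Suc N)}"
    using quadrature_cell[OF h F F' G, of "int N"] by (simp add: add.commute)
  \<comment> \<open>With \<open>c\<close> for \<open>h / 2\<close> and \<open>d\<close> for
    \<open>h\<^sup>2 / 12\<close> the claim is a polynomial identity in the boundary values;
    \<open>h2\<close> brings the goal into that shape.\<close>
  have h2: "complex_of_real h = 2 * complex_of_real (h / 2)" by simp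
  have "d * (b - a) - c * (y + x) + (d * (e - b) + c * (z + y) - 2 * c * S + (d * (g - e) - c * (w + z))) =
      d * (g - a) + c * (w + x) - 2 * c * (x + (w + S))" for a b c d e g x y z w S :: complex
    by (simp add: algebra_simps)
  note alg = this
  show ?case
    by (rule has_integral_eq_rhs[OF has_integral_combine[OF le(1,2) L
            has_integral_combine[OF le(3,4) Suc R]]])
       (simp only: sum h2 alg)
qed

lemma summable_quadrature_freq:
  "summable (\<lambda>k. 2 / (quadrature_freq h k)\<^sup>2)"
proof -
  have "summable (\<lambda>k. 2 * (h / (2 * pi))\<^sup>2 * (1 / real (Suc k) ^ 2))"
    by (intro summable_mult summable_inverse_Suc_squares)
  then show ?thesis
    by (simp add: quadrature_freq_def power_mult_distrib power_divide mult.assoc)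
qed

text \<open>The terms are dominated by \<open>norm (g x)\<close> times a summable sequence of
  constants, so sum and integral may be interchanged.\<close>

lemma quadrature_kernel_integral_sums:
  assumes g: "integrable lebesgue g"
  shows "integrable lebesgue (\<lambda>x. g x * of_real (quadrature_kernel h x))"
    and "(\<lambda>k. ((LINT x|lebesgue. g x * cis (quadrature_freq h k * x)) +
        (LINT x|lebesgue. g x * cis (- quadrature_freq h k * x))) / of_real ((quadrature_freq h k)\<^sup>2))
      sums (LINT x|lebesgue. g x * of_real (quadrature_kernel h x))"
proof -
  define w where "w = quadrature_freq h"
  define c where "c k x = 2 * cos (w k * x) / (w k)\<^sup>2" for k x
  define f where "f k x = g x * complex_of_real (c k x)" for k x
  have c_le: "\<bar>c k x\<bar> \<le> 2 / (w k)\<^sup>2" for k x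
    by (auto simp: c_def abs_mult intro!: divide_right_mono)
  have i: "integrable lebesgue (\<lambda>x. g x * cis (v * x))" for v
    by (intro integrable_lebesgue_mult_bounded_continuous[where B=1] g continuous_intros) simp
  \<comment> \<open>Twice the cosine is the sum of the exponentials at opposite frequencies.\<close>
  have feq: "f k x = (g x * cis (w k * x) + g x * cis (- w k * x)) / of_real ((w k)\<^sup>2)" for k x
    by (simp add: f_def c_def complex_eq_iff field_simps)
  have fi: "integrable lebesgue (f k)" for k
    unfolding feq by (intro integrable_divide_zero Bochner_Integration.integrable_add i)
  have sc: "summable (\<lambda>k. \<bar>c k x\<bar>)" for x
    by (rule summable_comparison_test'[OF summable_quadrature_freq[of h]])
       (use c_le in \<open>simp add: w_def\<close>)
  have 1: "AE x in lebesgue. summable (\<lambda>k. norm (f k x))"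
    by (simp add: f_def norm_mult summable_mult sc)
  have 2: "summable (\<lambda>k. LINT x|lebesgue. norm (f k x))"
  proof (rule summable_comparison_test'[OF summable_mult2[OF summable_quadrature_freq[of h]]])
    fix k
    have "(LINT x|lebesgue. norm (f k x)) \<le> (LINT x|lebesgue. 2 / (w k)\<^sup>2 * norm (g x))"
    proof (intro integral_mono)
      show "norm (f k x) \<le> 2 / (w k)\<^sup>2 * norm (g x)" for x
        using mult_left_mono[OF c_le[of k x], of "norm (g x)"] by (simp add: f_def norm_mult mult.commute)
    qed (use fi g in auto)
    then show "norm (LINT x|lebesgue. norm (f k x)) \<le>
        2 / (quadrature_freq h k)\<^sup>2 * (LINT x|lebesgue. norm (g x))"
      by (simp add: w_def)
  qed
  have sums: "(\<Sum>k. f k x) = g x * of_real (quadrature_kernel h x)" for x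
  proof -
    have "(\<lambda>k. c k x) sums quadrature_kernel h x"
      using summable_sums[OF summable_rabs_cancel[OF sc[of x]]]
      by (simp only: c_def w_def quadrature_kernel_def)
    then have "(\<lambda>k. f k x) sums (g x * of_real (quadrature_kernel h x))"
      unfolding f_def by (intro sums_mult sums_of_real)
    then show ?thesis by (simp add: sums_iff)
  qed
  show "integrable lebesgue (\<lambda>x. g x * of_real (quadrature_kernel h x))"
    using integrable_suminf[OF fi 1 2] by (simp add: sums)
  have "(LINT x|lebesgue. f k x) = ((LINT x|lebesgue. g x * cis (w k * x)) +
        (LINT x|lebesgue. g x * cis (- w k * x))) / of_real ((w k)\<^sup>2)" for k
    unfolding feq using i[of "w k"] i[of "- w k"]
    by (subst integral_divide_zero, subst Bochner_Integration.integral_add) auto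
  with sums_integral[OF fi 1 2]
  show "(\<lambda>k. ((LINT x|lebesgue. g x * cis (quadrature_freq h k * x)) +
        (LINT x|lebesgue. g x * cis (- quadrature_freq h k * x))) / of_real ((quadrature_freq h k)\<^sup>2))
      sums (LINT x|lebesgue. g x * of_real (quadrature_kernel h x))"
    by (simp add: sums w_def)
qed

text \<open>In the limit of growing symmetric intervals the boundary terms vanish, because
  \<open>F\<close>, \<open>F'\<close> and \<open>G\<close> are integrable. This also shows that the
  symmetric partial sums converge, so \<open>lim\<close> in the remainder is a genuine
  limit.\<close>

lemma quadrature_remainder_eq_kernel_integral:
  assumes h: "h > 0"
    and F: "\<And>x. (F has_vector_derivative F' x) (at x)"
    and F': "locally_absolutely_continuous F'"
    and G: "AE x in lebesgue. (F' has_vector_derivative G x) (at x)"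
    and int: "integrable lebesgue F" "integrable lebesgue F'" "integrable lebesgue G"
  shows "quadrature_remainder (2 * pi / h) F = (LINT x|lebesgue. G x * of_real (quadrature_kernel h x))"
proof -
  define K where "K x = G x * of_real (quadrature_kernel h x)" for x
  define S where "S N = (\<Sum>k\<in>{- int N..int N}. F (h * of_int k))" for N
  have K: "integrable lebesgue K"
    unfolding K_def by (rule quadrature_kernel_integral_sums(1)[OF int(3)])
  have contF': "continuous_on UNIV F'"
    by (rule locally_absolutely_continuous_imp_continuous[OF F'])
  have top: "filterlim (\<lambda>N. h * real N) at_top sequentially"
    using h by real_asymp
  have bot: "filterlim (\<lambda>N. - h * real N) at_bot sequentially"
    using h by real_asymp
  have abs: "filterlim (\<lambda>N. \<bar>h * real N\<bar>) at_top sequentially"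
    "filterlim (\<lambda>N. \<bar>- h * real N\<bar>) at_top sequentially"
    using top h by (simp_all add: abs_mult)
  have F0: "(\<lambda>N. F (a N)) \<longlonglongrightarrow> 0" and F'0: "(\<lambda>N. F' (a N)) \<longlonglongrightarrow> 0"
    if "filterlim (\<lambda>N. \<bar>a N\<bar>) at_top sequentially" for a
    using absolutely_continuous_tendsto_0[OF locally_absolutely_continuous_C1[OF F contF'] _ int(1,2) that]
      absolutely_continuous_tendsto_0[OF F' G int(2,3) that] F by simp_all
  have eq: "of_real h * S N = of_real (h\<^sup>2 / 12) * (F' (h * real N) - F' (- h * real N)) +
    of_real (h / 2) * (F (h * real N) + F (- h * real N)) -
    integral {- h * real N..h * real N} (\<lambda>x. K x - F x)" for N
    using integral_unique[OF quadrature_symmetric_range[OF h F F' G, of N]]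
    by (simp add: K_def S_def)
  have "(\<lambda>N. of_real h * S N) \<longlonglongrightarrow> of_real (h\<^sup>2 / 12) * (0 - 0) + of_real (h / 2) * (0 + 0) -
      (LINT x|lebesgue. K x - F x)"
    unfolding eq
    by (intro tendsto_intros F0 F'0 abs integral_exhausting_tendsto top bot
        Bochner_Integration.integrable_diff K int)
  then have "(\<lambda>N. of_real h * S N) \<longlonglongrightarrow> (LINT x|lebesgue. F x) - (LINT x|lebesgue. K x)"
    using K int by (simp add: Bochner_Integration.integral_diff)
  then have "(\<lambda>N. of_real h * S N / of_real h) \<longlonglongrightarrow> ((LINT x|lebesgue. F x) - (LINT x|lebesgue. K x)) / of_real h"
    using h by (intro tendsto_divide) auto
  then have "S \<longlonglongrightarrow> ((LINT x|lebesgue. F x) - (LINT x|lebesgue. K x)) / of_real h"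
    using h by simp
  then have "lim S = ((LINT x|lebesgue. F x) - (LINT x|lebesgue. K x)) / of_real h"
    by (rule limI)
  then show ?thesis
    using h by (simp add: quadrature_remainder_def S_def[abs_def] K_def)
qed

section \<open>Fourier integrals and the modulus of smoothness\<close>

lemma integrable_lebesgue_shift:
  fixes g :: "real \<Rightarrow> complex"
  assumes "integrable lebesgue g"
  shows "integrable lebesgue (\<lambda>x. g (x + c))"
  using lebesgue_integrable_real_affine[OF assms, of 1 c] by (simp add: add.commute)

lemma integral_lebesgue_shift:
  fixes g :: "real \<Rightarrow> 'b::euclidean_space"
  shows "(LINT x|lebesgue. g (x + c)) = (LINT x|lebesgue. g x)"
  using lebesgue_integral_real_affine[of 1 g c] by (simp add: add.commute)

lemma integrable_finite_difference:
  assumes "integrable lebesgue g"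
  shows "integrable lebesgue (finite_difference r u g)"
  unfolding finite_difference_def
  by (intro Bochner_Integration.integrable_sum integrable_mult_right integrable_lebesgue_shift assms)

text \<open>By translation invariance each summand costs its binomial coefficient times the norm of
  \<open>g\<close>. The bound is uniform in \<open>u\<close>, which makes the supremum in the
  modulus finite.\<close>

lemma L1_norm_finite_difference_le:
  assumes g: "integrable lebesgue g"
  shows "L1_norm (finite_difference r u g) \<le> 2 ^ r * L1_norm g"
proof -
  have i: "integrable lebesgue (\<lambda>x. real (r choose j) * norm (g (x + real j * u)))" for j
    by (intro integrable_mult_right integrable_norm integrable_lebesgue_shift g)
  have "L1_norm (finite_difference r u g) \<le>
      (LINT x|lebesgue. (\<Sum>j\<le>r. real (r choose j) * norm (g (x + real j * u))))"
    unfolding L1_norm_def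
  proof (rule integral_mono)
    show "integrable lebesgue (\<lambda>x. norm (finite_difference r u g x))"
      by (intro integrable_norm integrable_finite_difference g)
    show "integrable lebesgue (\<lambda>x. \<Sum>j\<le>r. real (r choose j) * norm (g (x + real j * u)))"
      by (intro Bochner_Integration.integrable_sum i)
    show "norm (finite_difference r u g x) \<le> (\<Sum>j\<le>r. real (r choose j) * norm (g (x + real j * u)))" for x
      unfolding finite_difference_def
      by (rule sum_norm_le) (simp add: norm_mult norm_power)
  qed
  also have "\<dots> = (\<Sum>j\<le>r. real (r choose j) * (LINT x|lebesgue. norm (g (x + real j * u))))"
    by (subst Bochner_Integration.integral_sum[OF i]) simp
  also have "\<dots> = (\<Sum>j\<le>r. real (r choose j) * L1_norm g)"
    by (simp add: integral_lebesgue_shift[of "\<lambda>x. norm (g x)"] L1_norm_def)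
  also have "\<dots> = real (\<Sum>j\<le>r. r choose j) * L1_norm g"
    by (simp add: sum_distrib_right)
  also have "\<dots> = 2 ^ r * L1_norm g"
    by (simp only: choose_row_sum) simp
  finally show ?thesis .
qed

lemma L1_norm_finite_difference_le_modulus:
  assumes g: "integrable lebesgue g" and u: "\<bar>u\<bar> \<le> \<delta>"
  shows "L1_norm (finite_difference r u g) \<le> modulus_of_smoothness r g \<delta>"
  unfolding modulus_of_smoothness_def
proof (rule cSUP_upper)
  show "bdd_above ((\<lambda>u. L1_norm (finite_difference r u g)) ` {- \<delta>..\<delta>})"
    using L1_norm_finite_difference_le[OF g] by (intro bdd_aboveI2)
qed (use u in auto)

text \<open>If \<open>e\<^bsup>iwu\<^esup> = -1\<close>, the difference operator multiplies the Fourier integral at \<open>w\<close> by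
  \<open>(-2)\<^sup>r\<close>.\<close>
lemma norm_fourier_integral_le_finite_difference:
  assumes g: "integrable lebesgue g" and w: "cis (w * u) = - 1"
  shows "2 ^ r * norm (LINT x|lebesgue. g x * cis (w * x)) \<le> L1_norm (finite_difference r u g)"
proof -
  define A where "A = (LINT x|lebesgue. g x * cis (w * x))"
  have i: "integrable lebesgue (\<lambda>x. h x * cis (w * x))" if "integrable lebesgue h" for h :: "real \<Rightarrow> complex"
    using that by (intro integrable_lebesgue_mult_bounded_continuous[where B=1] continuous_intros) simp_all
  have shift: "(LINT x|lebesgue. g (x + real j * u) * cis (w * x)) = (- 1) ^ j * A" for j
  proof -
    have "cis (w * (x + real j * u)) = (- 1) ^ j * cis (w * x)" for x
    proof -
      have "cis (w * (x + real j * u)) = cis (w * u) ^ j * cis (w * x)"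
        by (simp add: cis_mult Complex.DeMoivre algebra_simps)
      then show ?thesis by (simp add: w)
    qed
    \<comment> \<open>Translation by \<open>real j * u\<close> preserves the integral, while the
      exponential picks up the sign \<open>(- 1) ^ j\<close>, which is its own inverse.\<close>
    then have "A = (LINT x|lebesgue. (- 1) ^ j * (g (x + real j * u) * cis (w * x)))"
      unfolding A_def
      by (subst integral_lebesgue_shift[of "\<lambda>x. g x * cis (w * x)" "real j * u", symmetric])
         (simp add: mult_ac)
    then have "A = (- 1) ^ j * (LINT x|lebesgue. g (x + real j * u) * cis (w * x))"
      by simp
    then show ?thesis by (simp flip: mult.assoc power_mult_distrib)
  qed
  have "(LINT x|lebesgue. finite_difference r u g x * cis (w * x)) =
      (LINT x|lebesgue. (\<Sum>j\<le>r. (- 1) ^ (r - j) * of_nat (r choose j) * (g (x + real j * u) * cis (w * x))))"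
    by (simp only: finite_difference_def sum_distrib_right mult.assoc)
  also have "\<dots> = (\<Sum>j\<le>r. (- 1) ^ (r - j) * of_nat (r choose j) * ((- 1) ^ j * A))"
    by (subst Bochner_Integration.integral_sum)
       (auto intro!: integrable_mult_right i integrable_lebesgue_shift g simp: shift)
  also have "\<dots> = (\<Sum>j\<le>r. of_nat (r choose j) * (- 1) ^ j * (- 1) ^ (r - j)) * A"
    by (simp add: sum_distrib_left mult_ac)
  \<comment> \<open>Binomial expansion of the \<open>r\<close>-th power of
    \<open>(- 1) + (- 1)\<close>.\<close>
  also have "\<dots> = (- 2) ^ r * A"
    using binomial_ring[of "- 1 :: complex" "- 1" r] by simp
  finally have "2 ^ r * norm A = norm (LINT x|lebesgue. finite_difference r u g x * cis (w * x))"
    by (simp add: norm_mult norm_power)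
  also have "\<dots> \<le> (LINT x|lebesgue. norm (finite_difference r u g x * cis (w * x)))"
    by (rule integral_norm_bound)
  also have "\<dots> = L1_norm (finite_difference r u g)"
    by (simp add: L1_norm_def norm_mult)
  finally show ?thesis by (simp add: A_def)
qed

text \<open>The step \<open>u = pi / w\<close> shifts the phase by exactly \<open>pi\<close>, and
  the condition on \<open>\<delta>\<close> admits it in the supremum.\<close>

lemma norm_fourier_integral_le_modulus:
  assumes g: "integrable lebesgue g" and w: "w \<noteq> 0" and \<delta>: "pi / \<bar>w\<bar> \<le> \<delta>"
  shows "norm (LINT x|lebesgue. g x * cis (w * x)) \<le> modulus_of_smoothness r g \<delta> / 2 ^ r"
proof -
  have "2 ^ r * norm (LINT x|lebesgue. g x * cis (w * x)) \<le> L1_norm (finite_difference r (pi / w) g)"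
    using w by (intro norm_fourier_integral_le_finite_difference g) simp
  also have "\<dots> \<le> modulus_of_smoothness r g \<delta>"
    using \<delta> by (intro L1_norm_finite_difference_le_modulus g) (simp add: abs_divide)
  finally show ?thesis by (simp add: field_simps)
qed

lemma norm_fourier_integral_le_L1_norm:
  "norm (LINT x|lebesgue. g x * cis (w * x)) \<le> L1_norm g"
  using integral_norm_bound[of lebesgue "\<lambda>x. g x * cis (w * x)"] by (simp add: L1_norm_def norm_mult)

section \<open>Derivatives of Sobolev representatives\<close>

lemma real_deriv_Suc: "real_deriv (Suc k) F x = vector_derivative (real_deriv k F) (at x)"
  by (simp add: real_deriv_def)

lemma sobolev_representative_AE_derivative:
  assumes "sobolev_representative s f \<phi>" "k < s"
  shows "AE x in lebesgue. (real_deriv k \<phi> has_vector_derivative real_deriv (Suc k) \<phi> x) (at x)"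
proof -
  have "AE x in lebesgue. real_deriv k \<phi> differentiable (at x)"
    using assms by (simp add: sobolev_representative_def)
  then show ?thesis
    by (simp add: real_deriv_Suc vector_derivative_works)
qed

text \<open>\<open>F\<close> is a constant plus the integral of \<open>F'\<close>, and the integral
  of a continuous function is differentiable everywhere.\<close>

lemma has_vector_derivative_of_AE_continuous:
  assumes F: "locally_absolutely_continuous F"
    and F': "AE x in lebesgue. (F has_vector_derivative F' x) (at x)" and cont: "continuous_on UNIV F'"
  shows "(F has_vector_derivative F' x) (at x)"
proof -
  \<comment> \<open>Starting at \<open>x - 1\<close> makes \<open>x\<close> an interior point, so
    the derivative obtained is two-sided.\<close>
  have int: "((\<lambda>y. F (x - 1) + integral {x - 1..y} F') has_vector_derivative 0 + F' x) (at x within {x - 1..x + 1})"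
    by (intro has_vector_derivative_add has_vector_derivative_const integral_has_vector_derivative
        continuous_on_subset[OF cont]) auto
  have eq: "F y = F (x - 1) + integral {x - 1..y} F'" if "y \<in> {x - 1..x + 1}" for y
    using integral_unique[OF fundamental_theorem_of_calculus_AE[OF F _ F', of "x - 1" y]] that by simp
  have "(F has_vector_derivative F' x) (at x within {x - 1..x + 1})"
    by (rule has_vector_derivative_transform[OF _ eq int[unfolded add_0]]) simp_all
  moreover have "at x within {x - 1..x + 1} = at x"
    by (rule at_within_interior) simp
  ultimately show ?thesis by simp
qed

text \<open>\<open>Suc k < s\<close> makes the next derivative continuous, which upgrades the almost
  everywhere derivative to one at every point.\<close>

lemma sobolev_representative_has_vector_derivative:
  assumes "sobolev_representative s f \<phi>" "Suc k < s"
  shows "(real_deriv k \<phi> has_vector_derivative real_deriv (Suc k) \<phi> x) (at x)"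
  using assms
  by (intro has_vector_derivative_of_AE_continuous sobolev_representative_AE_derivative
      locally_absolutely_continuous_imp_continuous) (auto simp: sobolev_representative_def)

text \<open>The set where the functions differ is open and null, hence empty.\<close>

lemma continuous_AE_eq_imp_eq:
  fixes f g :: "real \<Rightarrow> complex"
  assumes f: "continuous_on UNIV f" and g: "continuous_on UNIV g" and eq: "AE x in lebesgue. f x = g x"
  shows "f = g"
proof (rule ccontr)
  assume "f \<noteq> g"
  then have "{x. f x \<noteq> g x} \<noteq> {}" by auto
  moreover have "open {x. f x \<noteq> g x}" by (intro open_Collect_neq f g)
  moreover have "negligible {x. f x \<noteq> g x}"
  proof -
    obtain N where N: "N \<in> null_sets lebesgue" "{x \<in> space lebesgue. \<not> f x = g x} \<subseteq> N"
      using eq by (auto simp: eventually_ae_filter)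
    then show ?thesis
      by (intro negligible_subset[OF N(1)[folded negligible_iff_null_sets]]) simp
  qed
  ultimately show False using open_not_negligible by blast
qed

text \<open>This identifies the representative picked by \<open>SOME\<close> in
  \<open>sobolev_deriv\<close> with \<open>f\<close> itself.\<close>

lemma sobolev_representative_eq:
  assumes \<phi>: "sobolev_representative s f \<phi>" and "s > 0" and f: "continuous_on UNIV f"
  shows "\<phi> = f"
proof (rule continuous_AE_eq_imp_eq[OF _ f])
  have "locally_absolutely_continuous (real_deriv 0 \<phi>)"
    using \<phi> \<open>s > 0\<close> unfolding sobolev_representative_def by blast
  then show "continuous_on UNIV \<phi>"
    by (simp add: real_deriv_def locally_absolutely_continuous_imp_continuous)
  show "AE x in lebesgue. \<phi> x = f x"
    using \<phi> by (simp add: sobolev_representative_def eq_commute)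
qed

text \<open>Each differentiation multiplies the Fourier integral by a factor of modulus
  \<open>\<bar>w\<bar>\<close>.\<close>

lemma norm_fourier_integral_derivative:
  assumes \<phi>: "sobolev_representative s f \<phi>" and "k + m \<le> s"
  shows "norm (LINT x|lebesgue. real_deriv (k + m) \<phi> x * cis (w * x)) =
    \<bar>w\<bar> ^ m * norm (LINT x|lebesgue. real_deriv k \<phi> x * cis (w * x))"
  using \<open>k + m \<le> s\<close>
proof (induction m)
  case (Suc m)
  have "(LINT x|lebesgue. real_deriv (Suc (k + m)) \<phi> x * cis (w * x)) =
      - \<i> * of_real w * (LINT x|lebesgue. real_deriv (k + m) \<phi> x * cis (w * x))"
    using \<phi> Suc.prems
    by (intro integral_derivative_cis sobolev_representative_AE_derivative[OF \<phi>])
       (auto simp: sobolev_representative_def)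
  then show ?case
    using Suc by (simp add: norm_mult)
qed simp

section \<open>The error bounds\<close>

lemma riemann_zeta_nat_sums:
  assumes "s \<ge> 2"
  shows "(\<lambda>k. 1 / real (Suc k) ^ s) sums riemann_zeta (real s)"
proof -
  have "summable (\<lambda>k. 1 / real (Suc k) ^ s)"
    using summable_Suc_iff[THEN iffD2, OF inverse_power_summable[OF assms]]
    by (simp add: inverse_eq_divide)
  moreover have "riemann_zeta (real s) = (\<Sum>k. 1 / real (Suc k) ^ s)"
    unfolding riemann_zeta_def by (intro suminf_cong) (simp add: powr_realpow)
  ultimately show ?thesis by (simp add: summable_sums)
qed

text \<open>Both estimates of the theorem are instances with different \<open>M\<close>. Two
  opposite frequencies contribute at most \<open>2 * M\<close> over the \<open>s\<close>-th power of
  the frequency, and the sum over \<open>k\<close> is a zeta value.\<close>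

lemma quadrature_remainder_bound:
  assumes f: "sobolev_representative s f f" and s: "s \<ge> 2" and h: "h > 0"
    and M: "\<And>k w. \<bar>w\<bar> = quadrature_freq h k \<Longrightarrow>
      norm (LINT x|lebesgue. real_deriv s f x * cis (w * x)) \<le> M"
  shows "norm (quadrature_remainder (2 * pi / h) f) \<le>
    h ^ s * (riemann_zeta (real s) / (pi ^ s * 2 ^ (s - 1))) * M"
proof -
  define A where "A w = (LINT x|lebesgue. real_deriv 2 f x * cis (w * x))" for w
  define v where "v = quadrature_freq h"
  have v: "v k > 0" for k using h by (simp add: v_def quadrature_freq_def)
  have d0: "real_deriv 0 f = f" by (simp add: real_deriv_def)
  have d: "(f has_vector_derivative real_deriv 1 f x) (at x)" for x
    using sobolev_representative_has_vector_derivative[OF f, of 0 x] s by (simp add: d0)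
  have ac: "locally_absolutely_continuous (real_deriv 1 f)"
    using f s by (auto simp: sobolev_representative_def)
  have "\<forall>k\<le>s. integrable lebesgue (real_deriv k f)"
    using f by (simp add: sobolev_representative_def)
  then have int: "integrable lebesgue (real_deriv 0 f)" "integrable lebesgue (real_deriv 1 f)"
    "integrable lebesgue (real_deriv 2 f)"
    using s by simp_all
  have d2: "AE x in lebesgue. (real_deriv 1 f has_vector_derivative real_deriv 2 f x) (at x)"
    using sobolev_representative_AE_derivative[OF f, of 1] s by (simp add: numeral_2_eq_2)
  have R: "quadrature_remainder (2 * pi / h) f =
      (LINT x|lebesgue. real_deriv 2 f x * of_real (quadrature_kernel h x))"
    by (rule quadrature_remainder_eq_kernel_integral[OF h d ac d2 int[unfolded d0]])
  have sums: "(\<lambda>k. (A (v k) + A (- v k)) / of_real ((v k)\<^sup>2)) sums quadrature_remainder (2 * pi / h) f"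
    using quadrature_kernel_integral_sums(2)[OF int(3), of h] by (simp only: R A_def v_def)
  \<comment> \<open>The kernel supplies two powers of \<open>1 / v k\<close>; the other
    \<open>s - 2\<close> come from passing from the second to the \<open>s\<close>-th
    derivative.\<close>
  have A: "norm (A w) \<le> M / v k ^ (s - 2)" if w: "\<bar>w\<bar> = v k" for w k
  proof -
    have "v k ^ (s - 2) * norm (A w) = norm (LINT x|lebesgue. real_deriv s f x * cis (w * x))"
      using norm_fourier_integral_derivative[OF f, of 2 "s - 2" w] w
      unfolding le_add_diff_inverse[OF s] by (simp add: A_def)
    also have "\<dots> \<le> M" using M w by (simp add: v_def)
    finally show ?thesis using v[of k] by (simp add: field_simps)
  qed
  have term_le: "norm ((A (v k) + A (- v k)) / of_real ((v k)\<^sup>2)) \<le> 2 * M * (h / (2 * pi)) ^ s * (1 / real (Suc k) ^ s)" for k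
  proof -
    have "norm (A (v k) + A (- v k)) \<le> 2 * M / v k ^ (s - 2)"
      using A[of "v k" k] A[of "- v k" k] v[of k] norm_triangle_ineq[of "A (v k)" "A (- v k)"] by simp
    then have "norm ((A (v k) + A (- v k)) / of_real ((v k)\<^sup>2)) \<le> 2 * M / v k ^ (s - 2) / (v k)\<^sup>2"
      unfolding norm_divide norm_of_real by (simp only: abs_power2) (intro divide_right_mono; simp)
    also have "\<dots> = 2 * M / v k ^ s"
      by (simp only: divide_divide_eq_left power_add[symmetric] le_add_diff_inverse2[OF s])
    also have "\<dots> = 2 * M * (h / (2 * pi)) ^ s * (1 / real (Suc k) ^ s)"
      by (simp add: v_def quadrature_freq_def power_divide power_mult_distrib del: of_nat_Suc)
    finally show ?thesis .
  qed
  have zeta: "(\<lambda>k. 2 * M * (h / (2 * pi)) ^ s * (1 / real (Suc k) ^ s)) sums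
      (2 * M * (h / (2 * pi)) ^ s * riemann_zeta (real s))"
    by (intro sums_mult riemann_zeta_nat_sums s)
  have "norm (quadrature_remainder (2 * pi / h) f) \<le> 2 * M * (h / (2 * pi)) ^ s * riemann_zeta (real s)"
    using norm_suminf_le[OF term_le sums_summable[OF zeta]]
    by (simp only: sums_unique[OF sums, symmetric] sums_unique[OF zeta, symmetric])
  also have "2 * M * (h / (2 * pi)) ^ s * riemann_zeta (real s) =
      h ^ s * (riemann_zeta (real s) / (pi ^ s * 2 ^ (s - 1))) * M"
  proof -
    \<comment> \<open>One factor 2 cancels against the 2 from the pair of opposite
      frequencies.\<close>
    have "(2::real) ^ s = 2 * 2 ^ (s - 1)" using s by (simp flip: power_Suc)
    then show ?thesis by (simp add: power_divide power_mult_distrib mult_ac)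
  qed
  finally show ?thesis .
qed

theorem theorem3p3:
  fixes s :: nat and f :: "real \<Rightarrow> complex"
  assumes "s \<ge> 2"
    and "f \<in> sobolev_W1 s \<inter> bcontfun"
  shows "(\<forall>r::nat. r \<ge> 1 \<longrightarrow> (\<forall>h::real. h > 0 \<longrightarrow>
            norm (quadrature_remainder (2 * pi / h) f) \<le>
              h ^ s * (riemann_zeta (real s) / (pi ^ s * 2 ^ (r + s - 1))) *
              modulus_of_smoothness r (sobolev_deriv s s f) (h / 2)))
       \<and> (\<forall>h::real. h > 0 \<longrightarrow>
            norm (quadrature_remainder (2 * pi / h) f) \<le>
              h ^ s * (riemann_zeta (real s) / (pi ^ s * 2 ^ (s - 1))) *
              L1_norm (sobolev_deriv s s f))"
proof -
  have cont: "continuous_on UNIV f" using assms(2) by (simp add: bcontfun_def)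
  have "\<exists>\<phi>. sobolev_representative s f \<phi>" using assms(2) by (simp add: sobolev_W1_def)
  then have rep: "sobolev_representative s f (SOME \<phi>. sobolev_representative s f \<phi>)"
    by (rule someI_ex)
  have "s > 0" using assms(1) by simp
  note eq = sobolev_representative_eq[OF rep this cont]
  have f: "sobolev_representative s f f" using rep unfolding eq .
  have deriv: "sobolev_deriv s s f = real_deriv s f" unfolding sobolev_deriv_def eq ..
  have g: "integrable lebesgue (real_deriv s f)"
    using f by (simp add: sobolev_representative_def)
  have 1: "norm (quadrature_remainder (2 * pi / h) f) \<le>
      h ^ s * (riemann_zeta (real s) / (pi ^ s * 2 ^ (r + s - 1))) *
      modulus_of_smoothness r (real_deriv s f) (h / 2)" if h: "h > 0" for r h
  proof -
    have "norm (quadrature_remainder (2 * pi / h) f) \<le>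
        h ^ s * (riemann_zeta (real s) / (pi ^ s * 2 ^ (s - 1))) *
        (modulus_of_smoothness r (real_deriv s f) (h / 2) / 2 ^ r)"
    proof (intro quadrature_remainder_bound f assms(1) h norm_fourier_integral_le_modulus g)
      fix k w assume w: "\<bar>w\<bar> = quadrature_freq h k"
      then show "w \<noteq> 0" using h by (auto simp: quadrature_freq_def)
      \<comment> \<open>This is where \<open>h / 2\<close> comes from: it is half a period at the
        lowest frequency, and higher frequencies need smaller translations.\<close>
      have "pi / \<bar>w\<bar> = h / 2 / real (Suc k)"
        using h by (simp add: w quadrature_freq_def)
      also have "\<dots> \<le> h / 2" using h by (simp add: field_simps)
      finally show "pi / \<bar>w\<bar> \<le> h / 2" .
    qed
    \<comment> \<open>The \<open>2 ^ r\<close> from the difference operator joins the constant;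
      \<open>s \<ge> 2\<close> keeps the natural subtraction from truncating.\<close>
    moreover have "(2::real) ^ (r + s - 1) = 2 ^ r * 2 ^ (s - 1)"
      using assms(1) by (simp flip: power_add)
    ultimately show ?thesis by (simp add: mult_ac)
  qed
  have 2: "norm (quadrature_remainder (2 * pi / h) f) \<le>
      h ^ s * (riemann_zeta (real s) / (pi ^ s * 2 ^ (s - 1))) * L1_norm (real_deriv s f)" if "h > 0" for h
    by (intro quadrature_remainder_bound f assms(1) that norm_fourier_integral_le_L1_norm)
  show ?thesis unfolding deriv using 1 2 by blast
qed

end
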